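(* For every $\varepsilon>0$, there is a (polynomial-time) $(4+\varepsilon)$-approximation algorithm for $2$-Load Coloring.
   Context: Graphs are finite, simple and undirected. For a nonnegative integer $k$ and a graph $G=(V,E)$, write $G\in(2,k)$-LCP if there is a map $\varphi:V\to\{1,2\}$ such that for each $i\in\{1,2\}$ at least $k$ edges have both endvertices colored $i$. $2$-Load Coloring (optimization problem): given a graph $G$, determine the maximum $k$, denoted $k_{opt}$, such that $G\in(2,k)$-LCP. The approximation ratio of an algorithm that outputs a value $k$ with $G\in(2,k)$-LCP is $k_{opt}/k$; thus an $r$-approximation algorithm is a polynomial-time algorithm that, on every input $G$, outputs $k$ with $G\in (2,k)$-LCP and $k_{opt}\le r\cdot k$. Here $\varepsilon$ is fixed, so the running time may depend arbitrarily on $\varepsilon$. *)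

theory Defs
  imports Complex_Main "HOL-Library.FuncSet" "HOL-Computational_Algebra.Polynomial"
begin

section \<open>2-load coloring\<close>

definition simple_graph :: "'a set \<Rightarrow> 'a set set \<Rightarrow> bool" where
  "simple_graph V E \<longleftrightarrow> finite V \<and> (\<forall>e\<in>E. e \<subseteq> V \<and> card e = 2)"

definition monochromatic_edges :: "'a set set \<Rightarrow> ('a \<Rightarrow> nat) \<Rightarrow> nat \<Rightarrow> 'a set set" where
  "monochromatic_edges E \<phi> i = {e \<in> E. \<forall>v\<in>e. \<phi> v = i}"

definition in_LCP2 :: "'a set \<Rightarrow> 'a set set \<Rightarrow> nat \<Rightarrow> bool" where
  "in_LCP2 V E k \<longleftrightarrow>
     (\<exists>\<phi> \<in> V \<rightarrow> {1, 2}. \<forall>i\<in>{1, 2}. k \<le> card (monochromatic_edges E \<phi> i))"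

definition k_opt :: "'a set \<Rightarrow> 'a set set \<Rightarrow> nat" where
  "k_opt V E = Max {k. in_LCP2 V E k}"

lemma in_LCP2_le_card:
  assumes "simple_graph V E" "in_LCP2 V E k"
  shows "k \<le> card E"
proof -
  have "finite E"
    using assms(1) finite_subset[of E "Pow V"] unfolding simple_graph_def by auto
  obtain \<phi> where "k \<le> card (monochromatic_edges E \<phi> 1)"
    using assms(2) unfolding in_LCP2_def by auto
  also have "\<dots> \<le> card E"
    unfolding monochromatic_edges_def by (rule card_mono[OF \<open>finite E\<close>]) auto
  finally show ?thesis .
qed

lemma in_LCP2_0: "in_LCP2 V E 0"
  unfolding in_LCP2_def by (auto intro!: bexI[of _ "\<lambda>_. 1"])

text \<open>On graphs, the maximum defining \<^const>\<open>k_opt\<close> is over a finite nonempty set.\<close>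

lemma k_opt:
  assumes "simple_graph V E"
  shows "in_LCP2 V E (k_opt V E)" and "in_LCP2 V E k \<Longrightarrow> k \<le> k_opt V E"
proof -
  have "{k. in_LCP2 V E k} \<subseteq> {..card E}"
    using in_LCP2_le_card[OF assms] by auto
  then have fin: "finite {k. in_LCP2 V E k}"
    using finite_subset by blast
  show "in_LCP2 V E (k_opt V E)"
    using Max_in[OF fin] in_LCP2_0 unfolding k_opt_def by blast
  show "in_LCP2 V E k \<Longrightarrow> k \<le> k_opt V E"
    using Max_ge[OF fin] unfolding k_opt_def by blast
qed


section \<open>Polynomial-time algorithms\<close>

text \<open>
  The machine model is the random access machine of Cook and Reckhow under the uniform cost
  measure, with structured control flow. The only arithmetic is addition and truncated
  subtraction: every step then lengthens the largest stored number by at most one bit, so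
  polynomial time on this machine coincides with polynomial time on Turing machines. (Unit-cost
  multiplication would break this.) A program text mentions finitely many registers; unbounded
  storage is available only through indirect addressing of the memory.
\<close>

datatype com =
    Assign nat nat          \<comment> \<open>\<open>R x := c\<close>\<close>
  | Add nat nat nat         \<comment> \<open>\<open>R x := R y + R z\<close>\<close>
  | Sub nat nat nat         \<comment> \<open>\<open>R x := R y - R z\<close>\<close>
  | Load nat nat            \<comment> \<open>\<open>R x := M (R y)\<close>\<close>
  | Store nat nat           \<comment> \<open>\<open>M (R x) := R y\<close>\<close>
  | Seq com com
  | If_Pos nat com com      \<comment> \<open>if \<open>R x > 0\<close>\<close>
  | While_Pos nat com       \<comment> \<open>while \<open>R x > 0\<close>\<close>

type_synonym state = "(nat \<Rightarrow> nat) \<times> (nat \<Rightarrow> nat)"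

text \<open>\<open>exec c s t s'\<close>: started in \<open>s\<close>, the program \<open>c\<close> halts in \<open>s'\<close> after \<open>t\<close> steps, where
  every elementary instruction and every test of a register is one step.\<close>

inductive exec :: "com \<Rightarrow> state \<Rightarrow> nat \<Rightarrow> state \<Rightarrow> bool" where
  Assign: "exec (Assign x c) (R, M) 1 (R(x := c), M)"
| Add: "exec (Add x y z) (R, M) 1 (R(x := R y + R z), M)"
| Sub: "exec (Sub x y z) (R, M) 1 (R(x := R y - R z), M)"
| Load: "exec (Load x y) (R, M) 1 (R(x := M (R y)), M)"
| Store: "exec (Store x y) (R, M) 1 (R, M(R x := R y))"
| Seq: "exec c1 s t1 s' \<Longrightarrow> exec c2 s' t2 s'' \<Longrightarrow> exec (Seq c1 c2) s (t1 + t2) s''"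
| If_True: "R x > 0 \<Longrightarrow> exec c1 (R, M) t s' \<Longrightarrow> exec (If_Pos x c1 c2) (R, M) (1 + t) s'"
| If_False: "R x = 0 \<Longrightarrow> exec c2 (R, M) t s' \<Longrightarrow> exec (If_Pos x c1 c2) (R, M) (1 + t) s'"
| While_True: "R x > 0 \<Longrightarrow> exec c (R, M) t1 s' \<Longrightarrow> exec (While_Pos x c) s' t2 s''
    \<Longrightarrow> exec (While_Pos x c) (R, M) (1 + t1 + t2) s''"
| While_False: "R x = 0 \<Longrightarrow> exec (While_Pos x c) (R, M) 1 (R, M)"

inductive_cases exec_elims:
  "exec (Assign x c) s t s'" "exec (Add x y z) s t s'" "exec (Sub x y z) s t s'"
  "exec (Load x y) s t s'" "exec (Store x y) s t s'" "exec (Seq c1 c2) s t s'"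
  "exec (If_Pos x c1 c2) s t s'"

inductive_cases exec_While_elim: "exec (While_Pos x c) s t s'"

lemma exec_deterministic:
  "exec c s t s' \<Longrightarrow> exec c s u s'' \<Longrightarrow> u = t \<and> s'' = s'"
proof (induction arbitrary: u s'' rule: exec.induct)
  case (Seq c1 s t1 s' c2 t2 s2)
  from Seq.prems show ?case
    by (rule exec_elims(6)) (metis Seq.IH)
next
  case (If_True R x c1 M t s' c2)
  from If_True.prems show ?case
    by (rule exec_elims(7)) (use If_True.hyps If_True.IH in \<open>fastforce+\<close>)
next
  case (If_False R x c2 M t s' c1)
  from If_False.prems show ?case
    by (rule exec_elims(7)) (use If_False.hyps If_False.IH in \<open>fastforce+\<close>)
next
  case (While_True R x c M t1 s' t2 s2)
  from While_True.prems show ?case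
  proof (rule exec_While_elim)
    fix R' M' v1 r v2
    assume *: "(R, M) = (R', M')" "u = Suc (v1 + v2)" "exec c (R', M') v1 r"
      "exec (While_Pos x c) r v2 s''"
    have "v1 = t1 \<and> r = s'"
      using * by (intro While_True.IH(1)) simp
    moreover from this have "v2 = t2 \<and> s'' = s2"
      using * by (intro While_True.IH(2)) simp
    ultimately show ?thesis
      using * by simp
  next
    fix R' M'
    assume "(R, M) = (R', M')" "R' x = 0"
    then show ?thesis
      using While_True.hyps(1) by (metis Pair_inject less_irrefl)
  qed
next
  case (While_False R x c M)
  from While_False.prems show ?case
    by (rule exec_While_elim) (use While_False.hyps in \<open>auto\<close>)
qed (auto elim: exec_elims(1-5))

text \<open>The input word is placed in the memory, its length in register 0; register 0 also holds
  the output.\<close>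

definition input_state :: "bool list \<Rightarrow> state" where
  "input_state w = ((\<lambda>_. 0)(0 := length w), \<lambda>i. if i < length w \<and> w ! i then 1 else 0)"

definition result :: "state \<Rightarrow> nat" where
  "result s = fst s 0"

text \<open>Input graphs have vertex set \<open>{..<n}\<close> and are given by their adjacency matrix, row by row.\<close>

definition adjacency_word :: "nat \<Rightarrow> nat set set \<Rightarrow> bool list" where
  "adjacency_word n E = concat (map (\<lambda>i. map (\<lambda>j. {i, j} \<in> E) [0..<n]) [0..<n])"

definition load_coloring_approximation :: "real \<Rightarrow> com \<Rightarrow> bool" where
  "load_coloring_approximation r c \<longleftrightarrow>
     (\<exists>p :: nat poly. \<forall>n E. simple_graph {..<n} E \<longrightarrow>
        (\<exists>t s. exec c (input_state (adjacency_word n E)) t s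
             \<and> t \<le> poly p (length (adjacency_word n E))
             \<and> in_LCP2 {..<n} E (result s)
             \<and> real (k_opt {..<n} E) \<le> r * real (result s)))"

end

theory Submission
  imports Defs
begin

text \<open>
  Let \<open>m\<close> be the number of edges and \<open>D\<close> the maximum degree. The two colour classes induce
  disjoint edge sets, one of which avoids a vertex of degree \<open>D\<close>, so \<open>k_opt \<le> U\<close> for
  \<open>U = min (m / 2) (m - D)\<close>. Conversely \<open>k = \<lceil>U / 4\<rceil>\<close> is attained once \<open>m \<ge> 200\<close>. Sort the
  vertices by degree and put the two vertices of each consecutive pair into different classes: the
  degree sums of the classes differ by at most \<open>D\<close>, and choosing the orientations greedily cuts at
  most half of the edges apart from a matching of \<open>\<mu>\<close> edges formed by the pairs. Both classes thus
  induce at least \<open>(m - \<mu> - D) / 4\<close> edges. If \<open>\<mu> \<ge> 2 k\<close>, splitting the matching suffices instead.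
  If neither works then \<open>D\<close> is about \<open>m / 4\<close> or more; then one class is a vertex \<open>v\<close> of degree \<open>D\<close>
  with \<open>k\<close> of its neighbours, chosen greedily such that a fraction of about \<open>(1 - k / D)\<^sup>2\<close> of the
  edges outside \<open>v\<close> survives.

  If \<open>m < 200\<close> then \<open>k_opt < 100\<close>, and an optimal colouring has a class that may be taken to consist
  of the endvertices of \<open>k_opt\<close> edges. It is found by trying all 200-tuples of vertices.
\<close>

section \<open>Load colorings of graphs\<close>

definition induced :: "'a set set \<Rightarrow> 'a set \<Rightarrow> 'a set set" where
  "induced E S = {e \<in> E. e \<subseteq> S}"

definition incident :: "'a set set \<Rightarrow> 'a \<Rightarrow> 'a set set" where
  "incident E v = {e \<in> E. v \<in> e}"

definition nbrs :: "'a set set \<Rightarrow> 'a \<Rightarrow> 'a set" where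
  "nbrs E v = {u. {v, u} \<in> E}"

lemma simple_graph_edge:
  assumes "simple_graph V E" "e \<in> E"
  shows "e \<subseteq> V" "card e = 2" "finite e"
  using assms unfolding simple_graph_def by (auto simp: card_ge_0_finite)

lemma simple_graph_finite:
  assumes "simple_graph V E"
  shows "finite V" "finite E"
  using assms finite_subset[of E "Pow V"] unfolding simple_graph_def by auto

lemma finite_induced [simp]: "finite E \<Longrightarrow> finite (induced E S)"
  and finite_incident [simp]: "finite E \<Longrightarrow> finite (incident E v)"
  unfolding induced_def incident_def by auto

lemma induced_mono: "S \<subseteq> T \<Longrightarrow> induced E S \<subseteq> induced E T"
  unfolding induced_def by auto

lemma induced_carrier [simp]: "simple_graph V E \<Longrightarrow> induced E V = E"
  unfolding induced_def using simple_graph_edge(1) by blast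

lemma edge_neq: "simple_graph V E \<Longrightarrow> {u, v} \<in> E \<Longrightarrow> u \<noteq> v"
  using simple_graph_edge(2)[of V E "{u, v}"] by auto

lemma incident_eq_image:
  assumes "simple_graph V E"
  shows "incident E v = (\<lambda>u. {v, u}) ` nbrs E v"
proof
  show "incident E v \<subseteq> (\<lambda>u. {v, u}) ` nbrs E v"
  proof
    fix e assume e: "e \<in> incident E v"
    then have "card e = 2" "v \<in> e" "e \<in> E"
      using simple_graph_edge[OF assms] by (auto simp: incident_def)
    then obtain u where "e = {v, u}"
      by (auto simp: card_2_iff)
    with \<open>e \<in> E\<close> show "e \<in> (\<lambda>u. {v, u}) ` nbrs E v"
      by (auto simp: nbrs_def)
  qed
qed (auto simp: incident_def nbrs_def)

lemma card_incident:
  assumes "simple_graph V E"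
  shows "card (incident E v) = card (nbrs E v)"
  unfolding incident_eq_image[OF assms]
  by (rule card_image) (auto simp: inj_on_def doubleton_eq_iff)

lemma nbrs_subset: "simple_graph V E \<Longrightarrow> nbrs E v \<subseteq> V - {v}"
  by (auto simp: nbrs_def dest: simple_graph_edge(1) edge_neq)

lemma card_filter_sum: "finite E \<Longrightarrow> card {e \<in> E. P e} = (\<Sum>e\<in>E. if P e then 1 else 0)"
  by (simp flip: sum.inter_filter)

lemma sum_incident:
  assumes "finite A" "finite E"
  shows "(\<Sum>v\<in>A. card (incident E v)) = (\<Sum>e\<in>E. card (e \<inter> A))"
proof -
  have "(\<Sum>v\<in>A. card (incident E v)) = (\<Sum>v\<in>A. \<Sum>e\<in>E. if v \<in> e then 1 else 0)"
    using assms by (simp add: incident_def card_filter_sum)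
  also have "\<dots> = (\<Sum>e\<in>E. \<Sum>v\<in>A. if v \<in> e then 1 else 0)"
    by (rule sum.swap)
  also have "\<dots> = (\<Sum>e\<in>E. card {v \<in> A. v \<in> e})"
    using assms by (simp add: card_filter_sum)
  also have "\<dots> = (\<Sum>e\<in>E. card (e \<inter> A))"
    by (intro sum.cong refl arg_cong[of _ _ card]) auto
  finally show ?thesis .
qed

lemma handshake:
  assumes "simple_graph V E"
  shows "(\<Sum>v\<in>V. card (incident E v)) = 2 * card E"
proof -
  have "(\<Sum>v\<in>V. card (incident E v)) = (\<Sum>e\<in>E. card (e \<inter> V))"
    using simple_graph_finite[OF assms] by (rule sum_incident)
  also have "\<dots> = (\<Sum>e\<in>E. 2)"
    using simple_graph_edge[OF assms] by (intro sum.cong) (auto simp: Int_absorb2)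
  finally show ?thesis by simp
qed

lemma simple_graph_induced: "simple_graph V E \<Longrightarrow> S \<subseteq> V \<Longrightarrow> simple_graph S (induced E S)"
  unfolding simple_graph_def induced_def by (auto dest: finite_subset)

lemma card_induced_insert:
  assumes "simple_graph V E" "a \<notin> A"
  shows "card (induced E (insert a A)) = card (induced E A) + card (nbrs E a \<inter> A)"
proof -
  have *: "{e \<in> incident E a. e \<subseteq> insert a A} = (\<lambda>u. {a, u}) ` (nbrs E a \<inter> A)"
    unfolding incident_eq_image[OF assms(1)] using edge_neq[OF assms(1)] by (auto simp: nbrs_def)
  have "card {e \<in> incident E a. e \<subseteq> insert a A} = card (nbrs E a \<inter> A)"
    unfolding * by (rule card_image) (auto simp: inj_on_def doubleton_eq_iff)
  moreover have "induced E (insert a A) = induced E A \<union> {e \<in> incident E a. e \<subseteq> insert a A}"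
    using assms(2) by (auto simp: induced_def incident_def)
  moreover have "induced E A \<inter> {e \<in> incident E a. e \<subseteq> insert a A} = {}"
    using assms(2) by (auto simp: induced_def incident_def)
  ultimately show ?thesis
    using simple_graph_finite[OF assms(1)] by (simp add: card_Un_disjoint)
qed

text \<open>An edge inside \<open>A\<close> adds 2 to the degree sum of \<open>A\<close>, an edge
  inside \<open>B\<close> adds 2 to that of \<open>B\<close>, and a cut edge adds 1 to both. A bound
  on the imbalance of the degree sums therefore bounds the imbalance of the induced edge
  counts.\<close>

lemma sum_incident_diff:
  assumes "simple_graph V E" "A \<union> B = V" "A \<inter> B = {}"
  shows "(\<Sum>v\<in>A. card (incident E v)) + 2 * card (induced E B)
       = (\<Sum>v\<in>B. card (incident E v)) + 2 * card (induced E A)"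
proof -
  have fin: "finite A" "finite B" "finite E"
    using simple_graph_finite[OF assms(1)] assms(2) by auto
  have "card (e \<inter> A) + 2 * (if e \<subseteq> B then 1 else 0) = card (e \<inter> B) + 2 * (if e \<subseteq> A then 1 else 0)"
    if e: "e \<in> E" for e
  proof -
    have "card e = 2" "e \<subseteq> V"
      using simple_graph_edge[OF assms(1) e] by auto
    then obtain x y where "e = {x, y}" "x \<noteq> y"
      by (auto simp: card_2_iff)
    with \<open>e \<subseteq> V\<close> assms(2,3) show ?thesis
      by (cases "x \<in> A"; cases "y \<in> A") (auto simp: Int_insert_left)
  qed
  then have "(\<Sum>e\<in>E. card (e \<inter> A) + 2 * (if e \<subseteq> B then 1 else 0))
      = (\<Sum>e\<in>E. card (e \<inter> B) + 2 * (if e \<subseteq> A then 1 else 0))"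
    by (rule sum.cong[OF refl])
  then show ?thesis
    using fin by (simp add: sum_incident sum.distrib induced_def card_filter_sum sum_distrib_left)
qed

section \<open>Colourings as vertex bipartitions, and upper bounds on their value\<close>

lemma in_LCP2_iff:
  assumes "simple_graph V E"
  shows "in_LCP2 V E k \<longleftrightarrow>
    (\<exists>S\<subseteq>V. k \<le> card (induced E S) \<and> k \<le> card (induced E (V - S)))"
proof
  assume "in_LCP2 V E k"
  then obtain \<phi> where \<phi>: "\<phi> \<in> V \<rightarrow> {1, 2}" "k \<le> card (monochromatic_edges E \<phi> 1)"
      "k \<le> card (monochromatic_edges E \<phi> 2)"
    unfolding in_LCP2_def by auto
  have "monochromatic_edges E \<phi> 1 = induced E {v\<in>V. \<phi> v = 1}"
    "monochromatic_edges E \<phi> 2 = induced E (V - {v\<in>V. \<phi> v = 1})"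
    using simple_graph_edge(1)[OF assms] \<phi>(1)
    unfolding monochromatic_edges_def induced_def by fastforce+
  with \<phi> show "\<exists>S\<subseteq>V. k \<le> card (induced E S) \<and> k \<le> card (induced E (V - S))"
    by (intro exI[of _ "{v\<in>V. \<phi> v = 1}"]) auto
next
  assume "\<exists>S\<subseteq>V. k \<le> card (induced E S) \<and> k \<le> card (induced E (V - S))"
  then obtain S where S: "S \<subseteq> V" "k \<le> card (induced E S)" "k \<le> card (induced E (V - S))"
    by auto
  define \<phi> :: "'a \<Rightarrow> nat" where "\<phi> v = (if v \<in> S then 1 else 2)" for v
  have "monochromatic_edges E \<phi> 1 = induced E S" "monochromatic_edges E \<phi> 2 = induced E (V - S)"
    using simple_graph_edge(1)[OF assms]
    unfolding monochromatic_edges_def induced_def \<phi>_def by (auto split: if_splits)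
  with S show "in_LCP2 V E k"
    unfolding in_LCP2_def by (intro bexI[of _ \<phi>]) (auto simp: \<phi>_def)
qed

lemma in_LCP2_mono: "in_LCP2 V E k \<Longrightarrow> j \<le> k \<Longrightarrow> in_LCP2 V E j"
  unfolding in_LCP2_def by (meson order_trans)

text \<open>Vertices outside \<open>S\<close> and \<open>T\<close> can join \<open>T\<close>, which
  only adds induced edges; constructions therefore need not cover \<open>V\<close>.\<close>

lemma in_LCP2_disjoint:
  assumes "simple_graph V E" "S \<inter> T = {}" "S \<subseteq> V" "T \<subseteq> V"
    "k \<le> card (induced E S)" "k \<le> card (induced E T)"
  shows "in_LCP2 V E k"
proof -
  have "card (induced E T) \<le> card (induced E (V - S))"
    using assms simple_graph_finite(2)[OF assms(1)] by (intro card_mono induced_mono) auto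
  with assms show ?thesis
    unfolding in_LCP2_iff[OF assms(1)] by (intro exI[of _ S]) auto
qed

lemma in_LCP2_upper_bounds:
  assumes "simple_graph V E" "in_LCP2 V E k"
  shows "2 * k \<le> card E" and "k + card (incident E v) \<le> card E"
proof -
  obtain S where S: "S \<subseteq> V" "k \<le> card (induced E S)" "k \<le> card (induced E (V - S))"
    using assms in_LCP2_iff by blast
  have fin: "finite E"
    using simple_graph_finite[OF assms(1)] by simp
  have "{} \<notin> E"
    using simple_graph_edge(2)[OF assms(1)] by force
  then have "induced E S \<inter> induced E (V - S) = {}"
    unfolding induced_def by auto (metis Diff_disjoint Int_subset_iff subset_empty)
  then have "card (induced E S) + card (induced E (V - S)) = card (induced E S \<union> induced E (V - S))"
    using fin by (simp add: card_Un_disjoint)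
  also have "\<dots> \<le> card E"
    using fin by (intro card_mono) (auto simp: induced_def)
  finally show "2 * k \<le> card E"
    using S by simp
  obtain T where T: "v \<notin> T" "k \<le> card (induced E T)"
    using S by (cases "v \<in> S") auto
  have "card (induced E T) + card (incident E v) = card (induced E T \<union> incident E v)"
    using fin T(1) by (subst card_Un_disjoint) (auto simp: induced_def incident_def)
  also have "\<dots> \<le> card E"
    using fin by (intro card_mono) (auto simp: induced_def incident_def)
  finally show "k + card (incident E v) \<le> card E"
    using T by simp
qed

text \<open>Keep \<open>k\<close> edges of one class and shrink the class to their endvertices: it
  still induces these edges, and its complement only grows. This bounds the search space of the
  exhaustive enumeration.\<close>

lemma in_LCP2_small_class:
  assumes "simple_graph V E" "in_LCP2 V E k"
  obtains S where "S \<subseteq> V" "card S \<le> 2 * k"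
    "k \<le> card (induced E S)" "k \<le> card (induced E (V - S))"
proof -
  obtain S where S: "S \<subseteq> V" "k \<le> card (induced E S)" "k \<le> card (induced E (V - S))"
    using assms in_LCP2_iff by blast
  have fin: "finite E" "finite V"
    using simple_graph_finite[OF assms(1)] by auto
  obtain F where F: "F \<subseteq> induced E S" "card F = k"
    using S(2) obtain_subset_with_card_n by blast
  have FE: "F \<subseteq> E"
    using F by (auto simp: induced_def)
  have "card (\<Union>F) \<le> (\<Sum>e\<in>F. card e)"
    by (rule card_Union_le_sum_card)
  also have "\<dots> = (\<Sum>e\<in>F. 2)"
    using simple_graph_edge(2)[OF assms(1)] FE by (intro sum.cong) auto
  finally have "card (\<Union>F) \<le> 2 * k"
    using F(2) by simp
  moreover have "\<Union>F \<subseteq> S"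
    using F(1) by (auto simp: induced_def)
  moreover have "F \<subseteq> induced E (\<Union>F)"
    using FE by (auto simp: induced_def)
  then have "k \<le> card (induced E (\<Union>F))"
    using F(2) fin by (metis card_mono finite_induced)
  moreover have "card (induced E (V - S)) \<le> card (induced E (V - \<Union>F))"
    using fin \<open>\<Union>F \<subseteq> S\<close> by (intro card_mono induced_mono) auto
  ultimately show thesis
    using S that[of "\<Union>F"] by auto
qed

section \<open>Constructions for the lower bound: star, matching, pair splitting\<close>

text \<open>Greedy deletion: some vertex of the \<open>s - w\<close> remaining ones carries at most a fraction
  \<open>2 / (s - w)\<close> of the remaining edges, and the factors \<open>1 - 2 / (s - w)\<close> telescope.\<close>

lemma sparse_deletion:
  fixes F :: "'a set set"
  assumes "finite F" "\<And>e. e \<in> F \<Longrightarrow> card e = 2" "finite N" "w \<le> card N"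
  shows "\<exists>W\<subseteq>N. card W = w \<and>
    int (card F) * ((int (card N) - int w) * (int (card N) - int w - 1))
      \<le> int (card {e \<in> F. e \<inter> W = {}}) * (int (card N) * (int (card N) - 1))"
  using assms(4)
proof (induction w)
  case 0
  show ?case by (intro exI[of _ "{}"]) auto
next
  case (Suc w)
  define s where "s = int (card N)"
  obtain W where W: "W \<subseteq> N" "card W = w"
    "int (card F) * ((s - int w) * (s - int w - 1))
      \<le> int (card {e \<in> F. e \<inter> W = {}}) * (s * (s - 1))"
    using Suc unfolding s_def by auto
  define F' where "F' = {e \<in> F. e \<inter> W = {}}"
  define N' where "N' = N - W"
  define r where "r = int (card N')"
  have r: "r = s - int w" "r \<ge> 1"
    using W Suc.prems assms(3) unfolding r_def N'_def s_def
    by (simp_all add: card_Diff_subset finite_subset of_nat_diff)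
  have fin: "finite F'" "finite N'"
    using assms by (auto simp: F'_def N'_def)
  have "(\<Sum>v\<in>N'. card (incident F' v)) = (\<Sum>e\<in>F'. card (e \<inter> N'))"
    using fin by (simp add: sum_incident)
  also have "\<dots> \<le> (\<Sum>e\<in>F'. 2)"
  proof (rule sum_mono)
    fix e assume "e \<in> F'"
    then have "card e = 2"
      using assms(2) by (auto simp: F'_def)
    then show "card (e \<inter> N') \<le> 2"
      by (metis card_ge_0_finite card_mono inf_le1 pos2)
  qed
  finally have sum_le: "(\<Sum>v\<in>N'. card (incident F' v)) \<le> 2 * card F'"
    by simp
  \<comment> \<open>Averaging: if every vertex of \<open>N'\<close> carried more than its share, the
    degree sum would exceed \<open>2 * card F'\<close>.\<close>
  have "\<exists>x\<in>N'. card N' * card (incident F' x) \<le> 2 * card F'"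
  proof (rule ccontr)
    assume "\<not> ?thesis"
    then have "(\<Sum>x\<in>N'. 2 * card F') < (\<Sum>x\<in>N'. card N' * card (incident F' x))"
      using fin r unfolding r_def by (intro sum_strict_mono) (auto simp: not_le)
    then show False
      using sum_le by (simp add: sum_distrib_left[symmetric])
  qed
  then obtain x where x: "x \<in> N'" "card N' * card (incident F' x) \<le> 2 * card F'"
    by auto
  define F'' where "F'' = {e \<in> F. e \<inter> insert x W = {}}"
  have "F' = F'' \<union> incident F' x" "F'' \<inter> incident F' x = {}"
    unfolding F'_def F''_def incident_def by auto
  then have "card F' = card F'' + card (incident F' x)"
    using fin by (metis card_Un_disjoint finite_Un)
  then have "r * int (card F') = r * int (card F'') + r * int (card (incident F' x))"
    by (simp add: algebra_simps)
  moreover have "r * int (card (incident F' x)) \<le> 2 * int (card F')"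
    using x(2) unfolding r_def by (metis of_nat_le_iff of_nat_mult of_nat_numeral)
  ultimately have del: "(r - 2) * int (card F') \<le> r * int (card F'')"
    by (simp add: algebra_simps)
  have s: "s \<ge> 1"
    using r by linarith
  have "int (card F) * ((r - 1) * (r - 2)) \<le> int (card F'') * (s * (s - 1))"
  \<comment> \<open>Multiplying the induction hypothesis by \<open>r - 2\<close> needs a nonnegative
    factor; for \<open>r = 1\<close> the left side vanishes.\<close>
  proof (cases "r \<ge> 2")
    case True
    have "r * (int (card F) * ((r - 1) * (r - 2))) = (r - 2) * (int (card F) * (r * (r - 1)))"
      by (simp add: algebra_simps)
    also have "\<dots> \<le> (r - 2) * (int (card F') * (s * (s - 1)))"
      using True W(3) unfolding F'_def r by (intro mult_left_mono) auto
    also have "\<dots> = ((r - 2) * int (card F')) * (s * (s - 1))"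
      by simp
    also have "\<dots> \<le> (r * int (card F'')) * (s * (s - 1))"
      using del s by (intro mult_right_mono) auto
    finally show ?thesis
      using r(2) by (simp add: mult.assoc)
  next
    case False
    then have "r = 1" using r by linarith
    then show ?thesis using s by simp
  qed
  moreover have "r - 1 = s - int (Suc w)" "r - 2 = s - int (Suc w) - 1"
    using r by auto
  ultimately have "int (card F) * ((s - int (Suc w)) * (s - int (Suc w) - 1))
      \<le> int (card F'') * (s * (s - 1))"
    by (simp only:)
  moreover have "insert x W \<subseteq> N" "card (insert x W) = Suc w"
    using x W assms(3) unfolding N'_def by (auto simp: finite_subset card_insert_if)
  ultimately show ?case
    unfolding F''_def s_def by blast
qed

text \<open>The first class is \<open>v\<close> with \<open>k\<close> of its neighbours, which
  already gives \<open>k\<close> edges. The neighbours come from \<open>sparse_deletion\<close> on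
  the edges avoiding \<open>v\<close>; the numerical hypothesis says, with denominators cleared,
  that more than \<open>k - 1\<close> of these edges survive.\<close>

lemma in_LCP2_star:
  assumes "simple_graph V E" "v \<in> V" "d = card (incident E v)" "k \<le> d"
    "(int k - 1) * (int d * (int d - 1)) < (int (card E) - int d) * ((int d - int k) * (int d - int k - 1))"
  shows "in_LCP2 V E k"
proof -
  define F where "F = E - incident E v"
  have fin: "finite E" "finite V"
    using simple_graph_finite[OF assms(1)] by auto
  have cF: "int (card F) = int (card E) - int d"
    unfolding F_def assms(3) using fin
    by (subst card_Diff_subset) (auto simp: incident_def intro!: of_nat_diff card_mono)
  have d: "card (nbrs E v) = d"
    using card_incident[OF assms(1)] assms(3) by simp
  have sub: "nbrs E v \<subseteq> V - {v}"
    using nbrs_subset[OF assms(1)] .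
  have "\<exists>W\<subseteq>nbrs E v. card W = k \<and>
    int (card F) * ((int (card (nbrs E v)) - int k) * (int (card (nbrs E v)) - int k - 1))
      \<le> int (card {e \<in> F. e \<inter> W = {}}) * (int (card (nbrs E v)) * (int (card (nbrs E v)) - 1))"
    using fin sub d assms(4) simple_graph_edge(2)[OF assms(1)]
    by (intro sparse_deletion) (auto simp: F_def dest: finite_subset)
  then obtain W where W: "W \<subseteq> nbrs E v" "card W = k"
    "(int (card E) - int d) * ((int d - int k) * (int d - int k - 1))
      \<le> int (card {e \<in> F. e \<inter> W = {}}) * (int d * (int d - 1))"
    unfolding d cF by auto
  define Q where "Q = int d * (int d - 1)"
  have "Q \<ge> 0"
    unfolding Q_def by (cases d) auto
  \<comment> \<open>\<open>Q\<close> is nonnegative, so it cancels from the strict inequality;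
    integrality then turns more than \<open>k - 1\<close> into at least \<open>k\<close>.\<close>
  have "(int k - 1) * Q < int (card {e \<in> F. e \<inter> W = {}}) * Q"
    using assms(5) W(3) unfolding Q_def by linarith
  then have "int k - 1 < int (card {e \<in> F. e \<inter> W = {}})"
    using \<open>Q \<ge> 0\<close> by (simp add: mult_less_cancel_right)
  then have "k \<le> card {e \<in> F. e \<inter> W = {}}"
    by linarith
  also have "{e \<in> F. e \<inter> W = {}} = induced E (V - insert v W)"
    using simple_graph_edge(1)[OF assms(1)] by (fastforce simp: F_def incident_def induced_def)
  finally have 2: "k \<le> card (induced E (V - insert v W))" .
  have "v \<notin> W"
    using W(1) sub by auto
  then have "card (induced E (insert v W)) = card (induced E W) + card (nbrs E v \<inter> W)"
    using card_induced_insert[OF assms(1)] by simp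
  then have 1: "k \<le> card (induced E (insert v W))"
    using W by (simp add: Int_absorb1)
  show ?thesis
    using 1 2 W(1) sub assms(2) by (intro iffD2[OF in_LCP2_iff[OF assms(1)]] exI[of _ "insert v W"]) auto
qed

text \<open>Give half of the matching edges to each class; disjoint edges have disjoint endvertex
  sets.\<close>

lemma in_LCP2_matching:
  assumes "simple_graph V E" "P \<subseteq> E" "pairwise disjnt P" "2 * k \<le> card P"
  shows "in_LCP2 V E k"
proof -
  have fin: "finite E" "finite P"
    using simple_graph_finite[OF assms(1)] assms(2) finite_subset by auto
  obtain Q where Q: "Q \<subseteq> P" "card Q = k"
    using assms(4) obtain_subset_with_card_n[of k P] by auto
  have "k \<le> card (P - Q)"
    using Q assms(4) fin by (subst card_Diff_subset) (auto dest: finite_subset)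
  also have "\<dots> \<le> card (induced E (\<Union>(P - Q)))"
    using fin assms(2) by (intro card_mono) (auto simp: induced_def)
  finally have 1: "k \<le> card (induced E (\<Union>(P - Q)))" .
  have "k \<le> card (induced E (\<Union>Q))"
    unfolding Q(2)[symmetric] using fin assms(2) Q(1) by (intro card_mono) (auto simp: induced_def)
  moreover have "\<Union>Q \<inter> \<Union>(P - Q) = {}"
  proof -
    have "disjnt e f" if "e \<in> Q" "f \<in> P - Q" for e f
      using that Q(1) by (intro pairwiseD[OF assms(3)]) auto
    then show ?thesis
      unfolding disjnt_def by blast
  qed
  moreover have "\<Union>Q \<subseteq> V" "\<Union>(P - Q) \<subseteq> V"
    using assms(2) Q(1) simple_graph_edge(1)[OF assms(1)] by blast+
  ultimately show ?thesis
    using 1 Q(1) by (intro in_LCP2_disjoint[OF assms(1), of "\<Union>Q" "\<Union>(P - Q)"]) auto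
qed

text \<open>Consecutive vertices in the degree order are separated. The order of each pair is chosen so
  that at most half of the edges to the later pairs are cut; only the edges inside a pair, which
  form the matching \<open>P\<close>, are cut unconditionally.\<close>

lemma pair_splitting:
  fixes E :: "'a set set"
  defines "d \<equiv> (\<lambda>v. card (incident E v))"
  assumes "simple_graph V E" "distinct xs" "set xs \<subseteq> V" "sorted_wrt (\<lambda>x y. d y \<le> d x) xs"
    "xs \<noteq> [] \<Longrightarrow> d (hd xs) \<le> b"
  shows "\<exists>A B P. A \<union> B = set xs \<and> A \<inter> B = {} \<and> P \<subseteq> induced E (set xs) \<and> pairwise disjnt P \<and>
    sum d A \<le> sum d B + b \<and> sum d B \<le> sum d A + b \<and>
    card (induced E (set xs)) \<le> 2 * (card (induced E A) + card (induced E B)) + card P"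
  using assms(3-)
proof (induction xs arbitrary: b rule: induct_list012)
  case 1
  show ?case
    by (intro exI[of _ "{}"]) (auto simp: pairwise_def)
next
  case (2 x)
  then show ?case
    by (intro exI[of _ "{x}"] exI[of _ "{}"]) (auto simp: pairwise_def)
next
  case (3 x y zs)
  \<comment> \<open>The bound for the tail is \<open>d y\<close>, since its vertices have degree at
    most \<open>d y\<close>. Separating \<open>x\<close> and \<open>y\<close> changes the imbalance
    by \<open>d x - d y\<close>, so it stays at most \<open>d x\<close>, whichever orientation is
    chosen.\<close>
  have "\<exists>A B P. A \<union> B = set zs \<and> A \<inter> B = {} \<and> P \<subseteq> induced E (set zs) \<and> pairwise disjnt P \<and>
    sum d A \<le> sum d B + d y \<and> sum d B \<le> sum d A + d y \<and>
    card (induced E (set zs)) \<le> 2 * (card (induced E A) + card (induced E B)) + card P"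
    using 3 by (intro "3.IH") auto
  then obtain A B P where IH: "A \<union> B = set zs" "A \<inter> B = {}" "P \<subseteq> induced E (set zs)"
    "pairwise disjnt P" "sum d A \<le> sum d B + d y" "sum d B \<le> sum d A + d y"
    "card (induced E (set zs)) \<le> 2 * (card (induced E A) + card (induced E B)) + card P"
    by blast
  have new: "x \<noteq> y" "x \<notin> set zs" "y \<notin> set zs" "x \<notin> A" "y \<notin> A" "x \<notin> B" "y \<notin> B"
    using "3.prems"(1) IH(1) by auto
  have fin: "finite A" "finite B" "finite E" "finite P"
    using IH(1,3) simple_graph_finite[OF assms(2)] finite_subset[OF IH(3)] finite_Un[of A B] by auto
  have dxy: "d y \<le> d x" "d x \<le> b"
    using "3.prems" by auto
  \<comment> \<open>The added set is empty if \<open>x\<close> and \<open>y\<close> are not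
    adjacent.\<close>
  define P' where "P' = P \<union> ({{x, y}} \<inter> E)"
  have P': "P' \<subseteq> induced E (set (x # y # zs))" "pairwise disjnt P'"
    "card P' = card P + card ({{x, y}} \<inter> E)"
  proof -
    have PU: "\<Union>P \<subseteq> set zs"
      using IH(3) by (auto simp: induced_def)
    show "P' \<subseteq> induced E (set (x # y # zs))"
      using IH(3) by (auto simp: P'_def induced_def)
    show "pairwise disjnt P'"
      using IH(4) PU new unfolding P'_def pairwise_def disjnt_def by blast
    show "card P' = card P + card ({{x, y}} \<inter> E)"
      unfolding P'_def using fin PU new by (intro card_Un_disjoint) auto
  qed
  have nb: "card (nbrs E u \<inter> set zs) = card (nbrs E u \<inter> A) + card (nbrs E u \<inter> B)" for u
    unfolding IH(1)[symmetric] Int_Un_distrib using fin IH(2)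
    by (intro card_Un_disjoint) auto
  have "nbrs E x \<inter> set (y # zs) = nbrs E x \<inter> set zs \<union> (nbrs E x \<inter> {y})"
    by auto
  then have "card (nbrs E x \<inter> set (y # zs)) = card (nbrs E x \<inter> set zs) + card (nbrs E x \<inter> {y})"
    using new by (simp add: card_Un_disjoint Int_insert_right)
  moreover have "card (nbrs E x \<inter> {y}) = card ({{x, y}} \<inter> E)"
    by (auto simp: nbrs_def Int_insert_right)
  ultimately have all: "card (induced E (set (x # y # zs))) = card (induced E (set zs)) +
      card (nbrs E y \<inter> A) + card (nbrs E y \<inter> B) + card (nbrs E x \<inter> A) + card (nbrs E x \<inter> B)
      + card ({{x, y}} \<inter> E)"
    using card_induced_insert[OF assms(2), of x "set (y # zs)"] new nb
      card_induced_insert[OF assms(2), of y "set zs"] by simp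
  have ind: "card (induced E (insert u A)) = card (induced E A) + card (nbrs E u \<inter> A)"
    "card (induced E (insert u B)) = card (induced E B) + card (nbrs E u \<inter> B)"
    if "u \<in> {x, y}" for u
    using card_induced_insert[OF assms(2)] that new by auto
  have sums: "sum d (insert u A) = d u + sum d A" "sum d (insert u B) = d u + sum d B"
    if "u \<in> {x, y}" for u
    using that new fin by auto
  show ?case
  \<comment> \<open>The two orientations keep complementary parts of the four counts of edges to
    \<open>A\<close> and \<open>B\<close>; the larger part is at least half.\<close>
  proof (cases "card (nbrs E x \<inter> A) + card (nbrs E y \<inter> B) \<ge> card (nbrs E y \<inter> A) + card (nbrs E x \<inter> B)")
    case True
    with IH P' new dxy all ind sums show ?thesis
      by (intro exI[of _ "insert x A"] exI[of _ "insert y B"] exI[of _ P']) auto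
  next
    case False
    with IH P' new dxy all ind sums show ?thesis
      by (intro exI[of _ "insert y A"] exI[of _ "insert x B"] exI[of _ P']) auto
  qed
qed

text \<open>By \<open>sum_incident_diff\<close>, degree sums differing by at most \<open>b\<close>
  force the induced edge counts to differ by at most \<open>b / 2\<close>. Twice their sum is then
  at most four times their minimum plus \<open>b\<close>.\<close>

lemma in_LCP2_or_matching:
  assumes "simple_graph V E" "\<And>v. v \<in> V \<Longrightarrow> card (incident E v) \<le> b"
  obtains P k where "P \<subseteq> E" "pairwise disjnt P" "in_LCP2 V E k" "card E \<le> 4 * k + card P + b"
proof -
  have "finite V"
    using simple_graph_finite[OF assms(1)] by simp
  define d where "d = (\<lambda>v. card (incident E v))"
  obtain ys where ys: "set ys = V" "distinct ys"
    using finite_distinct_list[OF \<open>finite V\<close>] by auto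
  define xs where "xs = rev (sort_key d ys)"
  have xs: "set xs = V" "distinct xs"
    using ys by (simp_all add: xs_def)
  have "sorted_wrt (\<lambda>x y. d y \<le> d x) xs"
    unfolding xs_def using sorted_sort_key[of d ys] by (simp add: sorted_wrt_rev sorted_wrt_map)
  moreover have "d (hd xs) \<le> b" if "xs \<noteq> []"
    using assms(2) hd_in_set[OF that] xs(1) by (simp add: d_def)
  ultimately obtain A B P where AB: "A \<union> B = V" "A \<inter> B = {}" "P \<subseteq> induced E V" "pairwise disjnt P"
    "sum d A \<le> sum d B + b" "sum d B \<le> sum d A + b"
    "card (induced E V) \<le> 2 * (card (induced E A) + card (induced E B)) + card P"
    using pair_splitting[OF assms(1), of xs b] xs unfolding d_def by auto
  define k where "k = min (card (induced E A)) (card (induced E B))"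
  have "in_LCP2 V E k"
    using AB(1,2) by (intro in_LCP2_disjoint[OF assms(1), of A B]) (auto simp: k_def)
  moreover have "card E \<le> 4 * k + card P + b"
    using AB sum_incident_diff[OF assms(1) AB(1,2)] assms(1) unfolding k_def d_def by auto
  ultimately show thesis
    using AB(3,4) assms(1) that by auto
qed

text \<open>The summands \<open>15\<close> encode rounding up: the last two hypotheses say that
  \<open>k\<close> is at most the ceiling of \<open>U / 4\<close>.\<close>

lemma in_LCP2_lower_bound:
  assumes "simple_graph V E" "\<And>v. v \<in> V \<Longrightarrow> card (incident E v) \<le> D"
    "v \<in> V" "card (incident E v) = D" "200 \<le> card E"
    "16 * k \<le> 2 * card E + 15" "16 * k + 4 * D \<le> 4 * card E + 15"
  shows "in_LCP2 V E k"
proof -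
  obtain P j where Pj: "P \<subseteq> E" "pairwise disjnt P" "in_LCP2 V E j" "card E \<le> 4 * j + card P + D"
    using in_LCP2_or_matching[OF assms(1,2)] by blast
  consider "2 * k \<le> card P" | "k \<le> j" | "card P < 2 * k" "j < k"
    by linarith
  then show ?thesis
  proof cases
    case 1
    then show ?thesis
      using in_LCP2_matching[OF assms(1) Pj(1,2)] by blast
  next
    case 2
    then show ?thesis
      using Pj(3) in_LCP2_mono by blast
  next
    case 3
    define m where "m = int (card E)"
    define d where "d = int D"
    define l where "l = int k - 1"
    \<comment> \<open>The last bound comes from \<open>card P \<le> 2 * k - 1\<close> and
      \<open>j \<le> k - 1\<close>. Combined with \<open>8 * l < m\<close> it yields
      \<open>2 * l \<le> d\<close> and \<open>d > m / 4 - 1\<close>.\<close>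
    have b: "l \<ge> 0" "m \<ge> 200" "8 * l < m" "4 * l + d < m" "m \<le> 6 * l + 1 + d"
    proof -
      have "card E + 5 \<le> 6 * k + D" "1 \<le> k"
        using 3 Pj(4) by auto
      then have "int (card E + 5) \<le> int (6 * k + D)" "int 1 \<le> int k" "int 200 \<le> int (card E)"
        "int (16 * k) \<le> int (2 * card E + 15)" "int (16 * k + 4 * D) \<le> int (4 * card E + 15)"
        using assms(5-7) by (simp_all only: of_nat_le_iff)
      then show "l \<ge> 0" "m \<ge> 200" "8 * l < m" "4 * l + d < m"
        "m \<le> 6 * l + 1 + d"
        unfolding m_def d_def l_def by simp_all
    qed
    have "l * (d * (d - 1)) < (m - d) * ((d - l - 1) * (d - l - 2))"
    proof (cases "m \<le> 3 * d")
      \<comment> \<open>Here \<open>l < 3 * d / 8\<close>, so the surviving fraction is about 25/64,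
        and 1/4 suffices because \<open>4 * l < m - d\<close>. The slack and
        \<open>d \<ge> 60\<close> absorb the lower-order terms.\<close>
      case True
      define x where "x = d - l - 2"
      then have "d = x + l + 2"
        by simp
      then have x: "0 < x" "5 * d - 16 \<le> 8 * x" "d \<ge> 60"
        using b True by linarith+
      have "60 * d \<le> d * d"
        using x(3) by (intro mult_right_mono) auto
      then have "16 * (d * (d - 1)) \<le> (5 * d - 16) * (5 * d - 16)"
      proof -
        have "16 * (d * (d - 1)) = 16 * (d * d) - 16 * d"
          "(5 * d - 16) * (5 * d - 16) = 25 * (d * d) - 160 * d + 256"
          by (simp_all add: algebra_simps)
        with \<open>60 * d \<le> d * d\<close> x(3) show ?thesis by linarith
      qed
      also have "\<dots> \<le> (8 * x) * (8 * x)"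
        using x by (intro mult_mono) auto
      also have "\<dots> \<le> 64 * ((x + 1) * x)"
        using x by (simp add: algebra_simps)
      finally have "l * (d * (d - 1)) \<le> l * (4 * ((x + 1) * x))"
        using b(1) by (intro mult_left_mono) (auto simp: mult.commute)
      also have "\<dots> = (4 * l) * ((x + 1) * x)"
        by simp
      also have "\<dots> < (m - d) * ((x + 1) * x)"
        using b x by (intro mult_strict_right_mono) auto
      finally show ?thesis
        by (simp add: x_def algebra_simps)
    next
      \<comment> \<open>Here \<open>2 * l \<le> d\<close> gives a surviving fraction of about 1/4,
        and 3/16 suffices because \<open>16 * l < 2 * m < 3 * (m - d)\<close>. The slack and
        \<open>d \<ge> 40\<close> absorb the lower-order terms.\<close>
      case False
      define x where "x = d - l - 2"
      then have "d = x + l + 2"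
        by simp
      then have x: "0 < x" "d - 4 \<le> 2 * x" "d \<ge> 40"
        using b False by linarith+
      have "40 * d \<le> d * d"
        using x(3) by (intro mult_right_mono) auto
      then have "3 * (d * (d - 1)) \<le> 4 * ((d - 2) * (d - 4))"
      proof -
        have "3 * (d * (d - 1)) = 3 * (d * d) - 3 * d"
          "4 * ((d - 2) * (d - 4)) = 4 * (d * d) - 24 * d + 32"
          by algebra+
        moreover have "3 * y - 3 * d \<le> 4 * y - 24 * d + 32" if "40 * d \<le> y" for y
          using that x(3) by linarith
        ultimately show ?thesis
          using \<open>40 * d \<le> d * d\<close> by metis
      qed
      also have "(d - 2) * (d - 4) \<le> (2 * (x + 1)) * (2 * x)"
        using x by (intro mult_mono) auto
      finally have "3 * (d * (d - 1)) \<le> 16 * ((x + 1) * x)"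
        by (simp add: algebra_simps)
      then have "l * (3 * (d * (d - 1))) \<le> l * (16 * ((x + 1) * x))"
        using b(1) by (intro mult_left_mono) (auto simp: mult.commute)
      also have "\<dots> = (16 * l) * ((x + 1) * x)"
        by simp
      also have "\<dots> < (3 * (m - d)) * ((x + 1) * x)"
        using b False x by (intro mult_strict_right_mono) auto
      finally have "3 * (l * (d * (d - 1))) < 3 * ((m - d) * ((x + 1) * x))"
        by (simp only: mult_ac)
      then have "l * (d * (d - 1)) < (m - d) * ((x + 1) * x)"
        by simp
      then show ?thesis
        by (simp add: x_def algebra_simps)
    qed
    moreover have "l + 1 \<le> d"
      using b by linarith
    then have "k \<le> D"
      by (simp add: d_def l_def)
    ultimately show ?thesis
      using assms(3,4) unfolding m_def d_def l_def
      by (intro in_LCP2_star[OF assms(1,3), of D]) (auto simp: algebra_simps)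
  qed
qed

section \<open>Verified programs\<close>

definition wp :: "com \<Rightarrow> (nat \<Rightarrow> state \<Rightarrow> bool) \<Rightarrow> state \<Rightarrow> bool" where
  "wp c Q s \<longleftrightarrow> (\<exists>t s'. exec c s t s' \<and> Q t s')"

lemma wp_Assign [simp]: "wp (Assign x c) Q (R, M) \<longleftrightarrow> Q 1 (R(x := c), M)"
  and wp_Add [simp]: "wp (Add x y z) Q (R, M) \<longleftrightarrow> Q 1 (R(x := R y + R z), M)"
  and wp_Sub [simp]: "wp (Sub x y z) Q (R, M) \<longleftrightarrow> Q 1 (R(x := R y - R z), M)"
  and wp_Load [simp]: "wp (Load x y) Q (R, M) \<longleftrightarrow> Q 1 (R(x := M (R y)), M)"
  and wp_Store [simp]: "wp (Store x y) Q (R, M) \<longleftrightarrow> Q 1 (R, M(R x := R y))"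
  unfolding wp_def by (auto intro: exec.intros[unfolded One_nat_def] elim!: exec_elims(1-5))

lemma wp_Seq [simp]: "wp (Seq c1 c2) Q s \<longleftrightarrow> wp c1 (\<lambda>t. wp c2 (\<lambda>u. Q (t + u))) s"
  unfolding wp_def by (blast intro: exec.Seq elim: exec_elims(6))

lemma wp_If_Pos [simp]:
  "wp (If_Pos x c1 c2) Q (R, M) \<longleftrightarrow>
    (if R x > 0 then wp c1 (\<lambda>t. Q (1 + t)) (R, M) else wp c2 (\<lambda>t. Q (1 + t)) (R, M))"
  unfolding wp_def by (auto intro: exec.If_True[simplified] exec.If_False[simplified] elim!: exec_elims(7))

lemma wp_mono: "wp c Q s \<Longrightarrow> (\<And>t R M. Q t (R, M) \<Longrightarrow> Q' t (R, M)) \<Longrightarrow> wp c Q' s"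
  unfolding wp_def by fastforce

text \<open>The index of \<open>I\<close> is the number of rounds still to come, so it gives
  termination and the time bound at once; the extra steps are the register tests.\<close>

lemma wp_While_Pos:
  assumes "I k s"
    and step: "\<And>i R M. I (Suc i) (R, M) \<Longrightarrow> R x > 0 \<and> wp c (\<lambda>t s'. t \<le> T \<and> I i s') (R, M)"
    and exit: "\<And>R M. I 0 (R, M) \<Longrightarrow> R x = 0"
  shows "wp (While_Pos x c) (\<lambda>t s'. t \<le> k * (T + 1) + 1 \<and> I 0 s') s"
  using assms(1)
proof (induction k arbitrary: s)
  case 0
  obtain R M where "s = (R, M)" by force
  with 0 exit show ?case
    unfolding wp_def by (fastforce intro: exec.While_False)
next
  case (Suc k)
  obtain R M where s: "s = (R, M)" by force
  with step Suc.prems obtain t s' where 1: "R x > 0" "exec c (R, M) t s'" "t \<le> T" "I k s'"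
    unfolding wp_def by blast
  with Suc.IH obtain u s'' where 2: "exec (While_Pos x c) s' u s''" "u \<le> k * (T + 1) + 1" "I 0 s''"
    unfolding wp_def by blast
  show ?case
    unfolding wp_def s using 1 2 exec.While_True[of R x c M t s' u s'']
    by (intro exI[of _ "1 + t + u"] exI[of _ s'']) auto
qed

abbreviation seq :: "com \<Rightarrow> com \<Rightarrow> com" (infixr ";;" 60) where
  "c1 ;; c2 \<equiv> Seq c1 c2"

text \<open>Registers. \<open>LEN\<close> has to be register 0, which holds the input length at the start and the
  output at the end.\<close>

abbreviation (input) "LEN \<equiv> 0 :: nat"
abbreviation (input) "ONE \<equiv> 2 :: nat"
abbreviation (input) "SIZE \<equiv> 3 :: nat"
abbreviation (input) "ZERO \<equiv> 4 :: nat"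
abbreviation (input) "EIGHT \<equiv> 5 :: nat"
abbreviation (input) "PTR \<equiv> 6 :: nat"
abbreviation (input) "ROW \<equiv> 7 :: nat"
abbreviation (input) "COL \<equiv> 8 :: nat"
abbreviation (input) "EDGE \<equiv> 9 :: nat"
abbreviation (input) "DEG \<equiv> 10 :: nat"
abbreviation (input) "MAXDEG \<equiv> 11 :: nat"
abbreviation (input) "DEGSUM \<equiv> 12 :: nat"
abbreviation (input) "BEST \<equiv> 13 :: nat"
abbreviation (input) "ADDR \<equiv> 14 :: nat"
abbreviation (input) "MARK1 \<equiv> 15 :: nat"
abbreviation (input) "MARK2 \<equiv> 16 :: nat"
abbreviation (input) "IN \<equiv> 17 :: nat"
abbreviation (input) "OUT \<equiv> 18 :: nat"
abbreviation (input) "TMP \<equiv> 19 :: nat"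
abbreviation (input) "SQUARE \<equiv> 20 :: nat"
abbreviation (input) "COUNTER d \<equiv> 30 + d :: nat"

definition For :: "nat \<Rightarrow> com \<Rightarrow> com" where
  "For x c = Add x SIZE ZERO ;; While_Pos x (Sub x x ONE ;; c)"

text \<open>The counter descends, so \<open>I i\<close> describes the state after the indices from
  \<open>i\<close> to \<open>n - 1\<close> have been processed. Each round pays for one test and one
  decrement besides the body.\<close>

lemma wp_For:
  assumes "R SIZE = n" "R ZERO = 0" "I n (R(x := n), M)"
    and inv: "\<And>i R M. I i (R, M) \<Longrightarrow> R x = i \<and> R ONE = 1"
    and step: "\<And>i R M. i < n \<Longrightarrow> I (Suc i) (R, M) \<Longrightarrow> wp c (\<lambda>t s. t \<le> T \<and> I i s) (R(x := i), M)"
  shows "wp (For x c) (\<lambda>t s. t \<le> n * (T + 2) + 2 \<and> I 0 s) (R, M)"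
proof -
  \<comment> \<open>The invariant carries \<open>i \<le> n\<close> so that the body may assume
    \<open>i < n\<close>; \<open>n \<ge> 0\<close> is its instance on exit.\<close>
  have "wp (While_Pos x (Sub x x ONE ;; c)) (\<lambda>t s. t \<le> n * (T + 1 + 1) + 1 \<and> n \<ge> 0 \<and> I 0 s) (R(x := n), M)"
  proof (rule wp_While_Pos[where I = "\<lambda>i s. n \<ge> i \<and> I i s"], goal_cases)
    case 1
    show ?case using assms(3) by simp
  next
    case (2 i R M)
    then have I: "i < n" "I (Suc i) (R, M)" by auto
    have *: "R(x := R x - R ONE) = R(x := i)" "R x > 0"
      using inv[OF I(2)] by auto
    show ?case
      using * wp_mono[OF step[OF I], of "\<lambda>t s. 1 + t \<le> T + 1 \<and> i \<le> n \<and> I i s"] I(1) by simp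
  next
    case (3 R M)
    then show ?case using inv by auto
  qed
  then show ?thesis
    unfolding For_def wp_Seq wp_Add assms(1,2) by simp
qed

section \<open>Memory layout and register conventions\<close>

definition graph_mem :: "nat \<Rightarrow> nat set set \<Rightarrow> (nat \<Rightarrow> nat) \<Rightarrow> bool" where
  "graph_mem n E M \<longleftrightarrow> (\<forall>i<n. \<forall>j<n. M (i * n + j) = (if {i, j} \<in> E then 1 else 0))"

text \<open>The cells \<open>n * n + i\<close> behind the adjacency matrix count how often the vertex \<open>i\<close> has been
  selected; the selected vertices form one colour class, the others form the second one.\<close>

definition marked :: "nat \<Rightarrow> (nat \<Rightarrow> nat) \<Rightarrow> nat set" where
  "marked n M = {i. i < n \<and> 0 < M (n * n + i)}"

definition std_regs :: "nat \<Rightarrow> (nat \<Rightarrow> nat) \<Rightarrow> bool" where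
  "std_regs n R \<longleftrightarrow> R LEN = n * n \<and> R ONE = 1 \<and> R SIZE = n \<and> R ZERO = 0 \<and> R EIGHT = 8"

text \<open>Frame condition that lets specifications of subprograms compose.\<close>

definition agree_off :: "nat set \<Rightarrow> (nat \<Rightarrow> nat) \<Rightarrow> (nat \<Rightarrow> nat) \<Rightarrow> bool" where
  "agree_off X R R' \<longleftrightarrow> (\<forall>r. r \<notin> X \<longrightarrow> R' r = R r)"

lemma agree_off_refl [simp]: "agree_off X R R"
  by (simp add: agree_off_def)

lemma agree_off_upd [simp]: "x \<in> X \<Longrightarrow> agree_off X R R' \<Longrightarrow> agree_off X R (R'(x := v))"
  by (auto simp: agree_off_def)

lemma agree_offD: "agree_off X R R' \<Longrightarrow> r \<notin> X \<Longrightarrow> R' r = R r"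
  by (simp add: agree_off_def)

lemma std_regs_upd [simp]: "x \<notin> {0, 2, 3, 4, 5} \<Longrightarrow> std_regs n (R(x := v)) \<longleftrightarrow> std_regs n R"
  by (auto simp: std_regs_def)

lemma std_regs_agree:
  assumes "agree_off X R R'" "std_regs n R" "X \<inter> {0, 2, 3, 4, 5} = {}"
  shows "std_regs n R'"
proof -
  have "R' r = R r" if "r \<in> {0, 2, 3, 4, 5}" for r
    using assms(1,3) that by (intro agree_offD[OF assms(1)]) auto
  with assms(2) show ?thesis
    by (simp add: std_regs_def)
qed

section \<open>Computing degrees and evaluating a colour class\<close>

definition degree_row :: com where
  "degree_row = For COL (Sub PTR PTR ONE ;; Load EDGE PTR ;; Add DEG DEG EDGE)"

text \<open>\<open>PTR\<close> moves backwards through the matrix in step with the descending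
  counters, which produces the addresses \<open>i * n + j\<close> without multiplication. The
  maximum is \<open>MAXDEG + (DEG - MAXDEG)\<close> with truncated subtraction.\<close>

definition degrees :: com where
  "degrees = Add PTR LEN ZERO ;;
     For ROW (Assign DEG 0 ;; degree_row ;; Sub TMP DEG MAXDEG ;; Add MAXDEG MAXDEG TMP ;;
       Add DEGSUM DEGSUM DEG)"

lemma sum_atLeastLessThan_head:
  "i < n \<Longrightarrow> (\<Sum>j = i..<n. f j) = f i + (\<Sum>j = Suc i..<n. f j :: nat)"
  by (simp add: sum.atLeast_Suc_lessThan)

lemma incident_eq_row_sum:
  fixes n :: nat
  assumes "simple_graph {..<n} E"
  shows "(\<Sum>j = 0..<n. if {i, j} \<in> E then 1 else 0) = card (incident E i)"
proof -
  have "nbrs E i = {j \<in> {0..<n}. {i, j} \<in> E}"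
    using simple_graph_edge(1)[OF assms] by (auto simp: nbrs_def)
  then show ?thesis
    by (simp add: card_incident[OF assms] flip: sum.inter_filter)
qed

lemma wp_degree_row:
  assumes "std_regs n R" "graph_mem n E M" "i < n" "R PTR = Suc i * n" "R DEG = 0"
  shows "wp degree_row (\<lambda>t (R', M'). t \<le> n * 5 + 2 \<and> M' = M \<and> R' PTR = i * n \<and>
      R' DEG = (\<Sum>j = 0..<n. if {i, j} \<in> E then 1 else 0) \<and>
      agree_off {PTR, COL, EDGE, DEG} R R') (R, M)"
proof -
  define I where "I = (\<lambda>k (R', M'). M' = M \<and> R' COL = k \<and> R' PTR = i * n + k \<and>
      R' DEG = (\<Sum>j = k..<n. if {i, j} \<in> E then 1 else 0) \<and>
      agree_off {PTR, COL, EDGE, DEG} R R')"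
  have std: "std_regs n R'" if "I k (R', M')" for k R' M'
    using that assms(1) by (auto simp: I_def elim: std_regs_agree)
  have "wp degree_row (\<lambda>t s. t \<le> n * (3 + 2) + 2 \<and> I 0 s) (R, M)"
    unfolding degree_row_def
  proof (rule wp_For)
    show "R SIZE = n" "R ZERO = 0" "I n (R(COL := n), M)"
      using assms by (auto simp: std_regs_def I_def)
    show "R COL = k \<and> R ONE = 1" if "I k (R, M)" for k R M
      using that std[OF that] by (auto simp: I_def std_regs_def)
    show "wp (Sub PTR PTR ONE ;; Load EDGE PTR ;; Add DEG DEG EDGE) (\<lambda>t s. t \<le> 3 \<and> I k s) (R(COL := k), M)"
      if "k < n" "I (Suc k) (R, M)" for k R M
      using that std[OF that(2)] assms(2,3)
      by (auto simp: I_def std_regs_def graph_mem_def sum_atLeastLessThan_head)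
  qed
  then show ?thesis
    by (rule wp_mono) (auto simp: I_def)
qed

lemma wp_degrees:
  assumes "simple_graph {..<n} E" "std_regs n R" "graph_mem n E M" "R MAXDEG = 0" "R DEGSUM = 0"
  shows "wp degrees (\<lambda>t (R', M'). t \<le> n * (n * 5 + 6 + 2) + 3 \<and> M' = M \<and> std_regs n R' \<and>
      R' DEGSUM = 2 * card E \<and> (\<forall>v<n. card (incident E v) \<le> R' MAXDEG) \<and>
      (R' MAXDEG = 0 \<or> (\<exists>v<n. card (incident E v) = R' MAXDEG))) (R, M)"
proof -
  define I where "I = (\<lambda>k (R', M'). M' = M \<and> std_regs n R' \<and> R' ROW = k \<and> R' PTR = k * n \<and>
      R' DEGSUM = (\<Sum>v = k..<n. card (incident E v)) \<and>
      (\<forall>v\<in>{k..<n}. card (incident E v) \<le> R' MAXDEG) \<and>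
      (R' MAXDEG = 0 \<or> (\<exists>v\<in>{k..<n}. card (incident E v) = R' MAXDEG)))"
  have "wp (For ROW (Assign DEG 0 ;; degree_row ;; Sub TMP DEG MAXDEG ;; Add MAXDEG MAXDEG TMP ;;
       Add DEGSUM DEGSUM DEG)) (\<lambda>t s. t \<le> n * (n * 5 + 6 + 2) + 2 \<and> I 0 s) (R(PTR := n * n), M)"
  proof (rule wp_For)
    show "(R(PTR := n * n)) SIZE = n" "(R(PTR := n * n)) ZERO = 0"
      "I n (R(PTR := n * n, ROW := n), M)"
      using assms by (auto simp: std_regs_def I_def)
    show "R ROW = k \<and> R ONE = 1" if "I k (R, M)" for k R M
      using that by (auto simp: I_def std_regs_def)
    fix k R M' assume k: "k < n" and I: "I (Suc k) (R, M')"
    then have [simp]: "M' = M" by (simp add: I_def)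
    define R1 where "R1 = R(ROW := k, DEG := 0)"
    have "wp degree_row (\<lambda>t (R', M'). t \<le> n * 5 + 2 \<and> M' = M \<and> R' PTR = k * n \<and>
      R' DEG = (\<Sum>j = 0..<n. if {k, j} \<in> E then 1 else 0) \<and>
      agree_off {PTR, COL, EDGE, DEG} R1 R') (R1, M)"
      using I k assms(3) by (intro wp_degree_row) (auto simp: I_def R1_def)
    then have "wp degree_row (\<lambda>t. wp (Sub TMP DEG MAXDEG ;; Add MAXDEG MAXDEG TMP ;;
       Add DEGSUM DEGSUM DEG) (\<lambda>u s. 1 + (t + u) \<le> n * 5 + 6 \<and> I k s)) (R1, M)"
    proof (rule wp_mono, clarify, goal_cases)
      case (1 t R' M'')
      have std: "std_regs n R'"
        using 1 I by (auto simp: I_def R1_def elim: std_regs_agree)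
      have eq: "R' MAXDEG = R MAXDEG" "R' DEGSUM = R DEGSUM" "R' ROW = k"
        using 1 by (auto simp: agree_off_def R1_def)
      have deg: "R' DEG = card (incident E k)"
        using 1 incident_eq_row_sum[OF assms(1)] by simp
      have split: "{k..<n} = insert k {Suc k..<n}"
        using k by auto
      show ?case
        using 1 I std eq deg by (auto simp: I_def split)
    qed
    then show "wp (Assign DEG 0 ;; degree_row ;; Sub TMP DEG MAXDEG ;; Add MAXDEG MAXDEG TMP ;;
       Add DEGSUM DEGSUM DEG) (\<lambda>t s. t \<le> n * 5 + 6 \<and> I k s) (R(ROW := k), M')"
      by (simp add: R1_def)
  qed
  then show ?thesis
    unfolding degrees_def wp_Seq wp_Add using assms(2) handshake[OF assms(1)]
    by (simp add: std_regs_def) (erule wp_mono, auto simp: I_def std_regs_def atLeast0LessThan)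
qed

text \<open>\<open>Assign TMP 0\<close> stands in for a skip instruction.\<close>

definition count_row :: com where
  "count_row = For COL (Sub PTR PTR ONE ;; Load EDGE PTR ;; Add ADDR LEN COL ;; Load MARK2 ADDR ;;
     If_Pos EDGE
       (If_Pos MARK1
         (If_Pos MARK2 (Add IN IN EIGHT) (Assign TMP 0))
         (If_Pos MARK2 (Assign TMP 0) (Add OUT OUT EIGHT)))
       (Assign TMP 0))"

text \<open>The last four instructions form the minimum \<open>IN - (IN - OUT)\<close> and then
  raise \<open>BEST\<close> to at least this value, using truncated subtraction.\<close>

definition count_marked :: com where
  "count_marked = Add PTR LEN ZERO ;; Assign IN 0 ;; Assign OUT 0 ;;
     For ROW (Add ADDR LEN ROW ;; Load MARK1 ADDR ;; count_row) ;;
     Sub TMP IN OUT ;; Sub TMP IN TMP ;; Sub TMP TMP BEST ;; Add BEST BEST TMP"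

abbreviation pairs_from :: "nat set set \<Rightarrow> nat set \<Rightarrow> nat \<Rightarrow> nat \<Rightarrow> nat \<Rightarrow> nat" where
  "pairs_from E S n i k \<equiv> (\<Sum>j = k..<n. if {i, j} \<in> E \<and> i \<in> S \<and> j \<in> S then 8 else 0)"

lemma wp_count_row:
  assumes "std_regs n R" "graph_mem n E M" "i < n" "R PTR = Suc i * n" "R MARK1 = M (n * n + i)"
  shows "wp count_row (\<lambda>t (R', M'). t \<le> n * 10 + 2 \<and> M' = M \<and> R' PTR = i * n \<and>
      R' IN = R IN + pairs_from E (marked n M) n i 0 \<and>
      R' OUT = R OUT + pairs_from E ({..<n} - marked n M) n i 0 \<and>
      agree_off {PTR, COL, EDGE, ADDR, MARK2, IN, OUT, TMP} R R') (R, M)"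
proof -
  define I where "I = (\<lambda>k (R', M'). M' = M \<and> R' COL = k \<and> R' PTR = i * n + k \<and>
      R' IN = R IN + pairs_from E (marked n M) n i k \<and>
      R' OUT = R OUT + pairs_from E ({..<n} - marked n M) n i k \<and>
      agree_off {PTR, COL, EDGE, ADDR, MARK2, IN, OUT, TMP} R R')"
  have std: "std_regs n R' \<and> R' MARK1 = M (n * n + i)" if "I k (R', M')" for k R' M'
    using that assms(1,5) agree_offD[of "{PTR, COL, EDGE, ADDR, MARK2, IN, OUT, TMP}" R R' MARK1]
    by (auto simp: I_def elim: std_regs_agree)
  have "wp count_row (\<lambda>t s. t \<le> n * (8 + 2) + 2 \<and> I 0 s) (R, M)"
    unfolding count_row_def
  proof (rule wp_For)
    show "R SIZE = n" "R ZERO = 0" "I n (R(COL := n), M)"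
      using assms by (auto simp: std_regs_def I_def)
    show "R COL = k \<and> R ONE = 1" if "I k (R, M)" for k R M
      using that std[OF that] by (auto simp: I_def std_regs_def)
    show "wp (Sub PTR PTR ONE ;; Load EDGE PTR ;; Add ADDR LEN COL ;; Load MARK2 ADDR ;;
     If_Pos EDGE
       (If_Pos MARK1
         (If_Pos MARK2 (Add IN IN EIGHT) (Assign TMP 0))
         (If_Pos MARK2 (Assign TMP 0) (Add OUT OUT EIGHT)))
       (Assign TMP 0)) (\<lambda>t s. t \<le> 8 \<and> I k s) (R(COL := k), M')"
      if "k < n" "I (Suc k) (R, M')" for k R M'
    proof -
      have "M' = M" using that by (simp add: I_def)
      moreover have "M (i * n + k) = (if {i, k} \<in> E then 1 else 0)"
        using that assms(2,3) by (simp add: graph_mem_def)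
      ultimately show ?thesis
        using that std[OF that(2)] assms(3)
        by (auto simp: I_def std_regs_def sum_atLeastLessThan_head marked_def)
    qed
  qed
  then show ?thesis
    by (rule wp_mono) (auto simp: I_def)
qed

text \<open>Each edge inside \<open>S\<close> is met from both endvertices, so increments of 8 add
  up to 16 per edge: the handshake identity in the induced subgraph.\<close>

lemma pairs_from_sum:
  assumes "simple_graph {..<n} E" "S \<subseteq> {..<n}"
  shows "(\<Sum>i = 0..<n. pairs_from E S n i 0) = 16 * card (induced E S)"
proof -
  have "pairs_from E S n i 0 = (if i \<in> S then 8 * card (incident (induced E S) i) else 0)" for i
  proof (cases "i \<in> S")
    case True
    have "simple_graph {..<n} (induced E S)"
      using assms(1) by (auto simp: simple_graph_def induced_def)
    from incident_eq_row_sum[OF this, of i]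
    have "8 * card (incident (induced E S) i) = (\<Sum>j = 0..<n. 8 * (if {i, j} \<in> induced E S then 1 else 0))"
      by (simp only: flip: sum_distrib_left)
    also have "\<dots> = pairs_from E S n i 0"
      using True by (intro sum.cong) (auto simp: induced_def)
    finally show ?thesis using True by simp
  qed auto
  then have "(\<Sum>i = 0..<n. pairs_from E S n i 0)
      = (\<Sum>i\<in>{0..<n}. if i \<in> S then 8 * card (incident (induced E S) i) else 0)"
    by simp
  also have "\<dots> = (\<Sum>i\<in>{i\<in>{0..<n}. i \<in> S}. 8 * card (incident (induced E S) i))"
    by (rule sum.inter_filter[symmetric]) simp
  also have "{i\<in>{0..<n}. i \<in> S} = S"
    using assms(2) by auto
  also have "(\<Sum>i\<in>S. 8 * card (incident (induced E S) i)) = 16 * card (induced E S)"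
    using handshake[OF simple_graph_induced[OF assms]] by (simp flip: sum_distrib_left)
  finally show ?thesis .
qed

text \<open>The factor 16 brings the size of an explicit colouring to the same scale as the degree bound
  \<open>min (2 * m) (4 * m - 4 * D)\<close>, which has to be divided by 16.\<close>

definition score :: "nat \<Rightarrow> nat set set \<Rightarrow> nat set \<Rightarrow> nat" where
  "score n E S = 16 * min (card (induced E S)) (card (induced E ({..<n} - S)))"

text \<open>The constants and the counters of \<open>enum\<close> lie outside this set and survive
  each evaluation.\<close>

definition scratch :: "nat set" where
  "scratch = {PTR, ROW, COL, EDGE, BEST, ADDR, MARK1, MARK2, IN, OUT, TMP}"

lemma wp_count_marked:
  assumes "simple_graph {..<n} E" "std_regs n R" "graph_mem n E M"
  shows "wp count_marked (\<lambda>t (R', M'). t \<le> n * (n * 10 + 4 + 2) + 9 \<and> M' = M \<and>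
      agree_off scratch R R' \<and> R' BEST = max (R BEST) (score n E (marked n M))) (R, M)"
proof -
  define I where "I = (\<lambda>k (R', M'). M' = M \<and> R' ROW = k \<and> R' PTR = k * n \<and> R' BEST = R BEST \<and>
      R' IN = (\<Sum>i = k..<n. pairs_from E (marked n M) n i 0) \<and>
      R' OUT = (\<Sum>i = k..<n. pairs_from E ({..<n} - marked n M) n i 0) \<and>
      agree_off scratch R R')"
  have std: "std_regs n R'" if "I k (R', M')" for k R' M'
    using that assms(2) by (auto simp: I_def scratch_def elim: std_regs_agree)
  define R0 where "R0 = R(PTR := n * n, IN := 0, OUT := 0)"
  have "wp (For ROW (Add ADDR LEN ROW ;; Load MARK1 ADDR ;; count_row))
      (\<lambda>t s. t \<le> n * (n * 10 + 4 + 2) + 2 \<and> I 0 s) (R0, M)"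
  proof (rule wp_For)
    show "R0 SIZE = n" "R0 ZERO = 0" "I n (R0(ROW := n), M)"
      using assms(2) by (auto simp: std_regs_def I_def R0_def scratch_def)
    show "R ROW = k \<and> R ONE = 1" if "I k (R, M)" for k R M
      using that std[OF that] by (auto simp: I_def std_regs_def)
    fix k R1 M' assume k: "k < n" and I: "I (Suc k) (R1, M')"
    then have [simp]: "M' = M" by (simp add: I_def)
    define R2 where "R2 = R1(ROW := k, ADDR := n * n + k, MARK1 := M (n * n + k))"
    have R2: "std_regs n R2" "R2 PTR = Suc k * n" "R2 MARK1 = M (n * n + k)"
      using I std[OF I] unfolding R2_def by (simp_all add: I_def)
    have "wp count_row (\<lambda>t (R', M'). t \<le> n * 10 + 2 \<and> M' = M \<and> R' PTR = k * n \<and>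
      R' IN = R2 IN + pairs_from E (marked n M) n k 0 \<and>
      R' OUT = R2 OUT + pairs_from E ({..<n} - marked n M) n k 0 \<and>
      agree_off {PTR, COL, EDGE, ADDR, MARK2, IN, OUT, TMP} R2 R') (R2, M)"
      using R2 k assms(3) by (intro wp_count_row)
    then have "wp count_row (\<lambda>t s. 2 + t \<le> n * 10 + 4 \<and> I k s) (R2, M)"
    proof (rule wp_mono, clarify, goal_cases)
      case (1 t R' M'')
      have "R' ROW = k" "R' BEST = R BEST"
        using 1 I by (auto simp: agree_off_def R2_def I_def)
      moreover have "agree_off scratch R R'"
        using 1 I unfolding I_def R2_def agree_off_def scratch_def by auto
      ultimately show ?case
        using 1 I k by (auto simp: I_def R2_def sum_atLeastLessThan_head)
    qed
    then show "wp (Add ADDR LEN ROW ;; Load MARK1 ADDR ;; count_row)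
        (\<lambda>t s. t \<le> n * 10 + 4 \<and> I k s) (R1(ROW := k), M')"
      using std[OF I] by (simp add: R2_def std_regs_def)
  qed
  then have "wp (For ROW (Add ADDR LEN ROW ;; Load MARK1 ADDR ;; count_row))
      (\<lambda>t. wp (Sub TMP IN OUT ;; Sub TMP IN TMP ;; Sub TMP TMP BEST ;; Add BEST BEST TMP)
        (\<lambda>u (R', M'). 3 + (t + u) \<le> n * (n * 10 + 4 + 2) + 9 \<and> M' = M \<and>
          agree_off scratch R R' \<and> R' BEST = max (R BEST) (score n E (marked n M)))) (R0, M)"
  proof (rule wp_mono, goal_cases)
    case (1 t R' M')
    have "marked n M \<subseteq> {..<n}"
      by (auto simp: marked_def)
    then have "R' IN = 16 * card (induced E (marked n M))"
      "R' OUT = 16 * card (induced E ({..<n} - marked n M))"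
      using 1 pairs_from_sum[OF assms(1), of "marked n M"]
        pairs_from_sum[OF assms(1), of "{..<n} - marked n M"] by (auto simp: I_def)
    with 1 show ?case
      by (auto simp: I_def score_def scratch_def)
  qed
  then show ?thesis
    unfolding count_marked_def using assms(2) by (simp add: R0_def std_regs_def)
qed

section \<open>Exhaustive enumeration of tuples\<close>

text \<open>\<open>enum d\<close> tries all \<open>d\<close>-tuples of additionally selected vertices, by \<open>d\<close> nested loops.\<close>

fun enum :: "nat \<Rightarrow> com" where
  "enum 0 = count_marked"
| "enum (Suc d) = For (COUNTER d)
    (Add ADDR LEN (COUNTER d) ;; Load MARK1 ADDR ;; Add MARK1 MARK1 ONE ;; Store ADDR MARK1 ;;
     enum d ;;
     Add ADDR LEN (COUNTER d) ;; Load MARK1 ADDR ;; Sub MARK1 MARK1 ONE ;; Store ADDR MARK1)"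

fun enum_time :: "nat \<Rightarrow> nat \<Rightarrow> nat" where
  "enum_time 0 n = n * (n * 10 + 4 + 2) + 9"
| "enum_time (Suc d) n = n * (enum_time d n + 8 + 2) + 2"

text \<open>The argument \<open>n * n\<close> is the input length. Each nested loop costs a factor
  \<open>n \<le> n * n\<close>, and the nesting depth is a constant.\<close>

lemma enum_time_poly: "\<exists>p. \<forall>n. enum_time d n \<le> poly p (n * n)"
proof (induction d)
  case 0
  have "n * (n * 10 + 4 + 2) + 9 \<le> poly [:9, 16:] (n * n)" for n :: nat
    using le_square[of n] by (simp add: algebra_simps)
  then show ?case
    unfolding enum_time.simps by blast
next
  case (Suc d)
  then obtain p where p: "enum_time d n \<le> poly p (n * n)" for n
    by auto
  have "enum_time (Suc d) n \<le> poly ([:0, 1:] * (p + [:10:]) + [:2:]) (n * n)" for n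
    using mult_mono[OF le_square[of n], of "enum_time d n + 10" "poly p (n * n) + 10"] p[of n] by (simp add: add.commute)
  then show ?case by blast
qed

text \<open>A new value of \<open>BEST\<close> is attained by a colouring, and it dominates all
  tuples. The memory is arbitrary because outer loops have already marked vertices.\<close>

lemma wp_enum:
  assumes "simple_graph {..<n} E" "std_regs n R" "graph_mem n E M"
  shows "wp (enum d) (\<lambda>t (R', M'). t \<le> enum_time d n \<and> M' = M \<and>
      agree_off (scratch \<union> {30..<30 + d}) R R' \<and> R BEST \<le> R' BEST \<and>
      (R' BEST = R BEST \<or> (\<exists>S\<subseteq>{..<n}. R' BEST = score n E S)) \<and>
      (\<forall>xs. set xs \<subseteq> {..<n} \<longrightarrow> length xs = d \<longrightarrow> score n E (marked n M \<union> set xs) \<le> R' BEST)) (R, M)"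
  using assms(2,3)
proof (induction d arbitrary: R M)
  case 0
  have "marked n M \<subseteq> {..<n}"
    by (auto simp: marked_def)
  then have *: "max (R BEST) (score n E (marked n M)) = R BEST \<or>
      (\<exists>S\<subseteq>{..<n}. max (R BEST) (score n E (marked n M)) = score n E S)"
    by (auto simp: max_def)
  show ?case
    unfolding enum.simps using wp_count_marked[OF assms(1) 0]
  proof (rule wp_mono, goal_cases)
    case (1 t R' M')
    with * show ?case by simp
  qed
next
  case (Suc d)
  define I where "I = (\<lambda>k (R', M'). M' = M \<and> R' (COUNTER d) = k \<and>
      agree_off (scratch \<union> {30..<30 + Suc d}) R R' \<and> R BEST \<le> R' BEST \<and>
      (R' BEST = R BEST \<or> (\<exists>S\<subseteq>{..<n}. R' BEST = score n E S)) \<and>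
      (\<forall>x xs. k \<le> x \<longrightarrow> x < n \<longrightarrow> set xs \<subseteq> {..<n} \<longrightarrow> length xs = d \<longrightarrow>
        score n E (marked n M \<union> insert x (set xs)) \<le> R' BEST))"
  have std: "std_regs n R'" if "I k (R', M')" for k R' M'
    using that Suc.prems(1) by (auto simp: I_def scratch_def elim!: std_regs_agree)
  have "wp (enum (Suc d)) (\<lambda>t s. t \<le> n * (enum_time d n + 8 + 2) + 2 \<and> I 0 s) (R, M)"
    unfolding enum.simps
  proof (rule wp_For)
    show "R SIZE = n" "R ZERO = 0" "I n (R(COUNTER d := n), M)"
      using Suc.prems by (auto simp: std_regs_def I_def scratch_def)
    show "R (COUNTER d) = k \<and> R ONE = 1" if "I k (R, M)" for k R M
      using that std[OF that] by (auto simp: I_def std_regs_def)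
    fix k R1 M' assume k: "k < n" and I: "I (Suc k) (R1, M')"
    then have [simp]: "M' = M" by (simp add: I_def)
    \<comment> \<open>Counting instead of flagging lets the later decrement restore \<open>M\<close>
      even if \<open>k\<close> was already selected.\<close>
    define M1 where "M1 = M(n * n + k := Suc (M (n * n + k)))"
    define R2 where "R2 = R1(COUNTER d := k, ADDR := n * n + k, MARK1 := Suc (M (n * n + k)))"
    have marked: "marked n M1 = insert k (marked n M)"
      using k by (auto simp: marked_def M1_def)
    \<comment> \<open>The counter cells lie behind the matrix, so marking leaves the graph
      intact.\<close>
    have "i * n + j < n * n" if "i < n" "j < n" for i j
      using that mult_le_mono1[of "Suc i" n n] by simp
    then have mem: "graph_mem n E M1"
      using Suc.prems(2) unfolding graph_mem_def M1_def by fastforce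
    have R2: "std_regs n R2"
      using std[OF I] by (auto simp: R2_def)
    have "wp (enum d) (\<lambda>t. wp (Add ADDR LEN (COUNTER d) ;; Load MARK1 ADDR ;; Sub MARK1 MARK1 ONE ;;
        Store ADDR MARK1) (\<lambda>u s. 4 + (t + u) \<le> enum_time d n + 8 \<and> I k s)) (R2, M1)"
      using Suc.IH[OF R2 mem]
    proof (rule wp_mono, clarify, goal_cases)
      case (1 t R' M'')
      have std': "std_regs n R'"
        using 1 R2 by (auto simp: scratch_def elim!: std_regs_agree)
      have C: "R' (COUNTER d) = k"
        using 1 by (auto simp: agree_off_def scratch_def R2_def)
      have agree: "agree_off (scratch \<union> {30..<30 + Suc d}) R R'"
        using 1 I unfolding I_def R2_def agree_off_def scratch_def by auto
      have B: "R2 BEST = R1 BEST"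
        by (simp add: R2_def)
      have M: "M1(n * n + k := M (n * n + k)) = M"
        by (auto simp: M1_def)
      define R3 where "R3 = R'(ADDR := n * n + k, MARK1 := M (n * n + k))"
      have R3: "agree_off (scratch \<union> {30..<30 + Suc d}) R R3" "R3 BEST = R' BEST" "R3 (COUNTER d) = k"
        using agree C by (auto simp: R3_def scratch_def)
      \<comment> \<open>Tuples starting with \<open>k\<close> are covered by the inner enumeration,
        those with a larger first entry by the invariant and the monotonicity of
        \<open>BEST\<close>.\<close>
      have cover: "score n E (marked n M \<union> insert x (set xs)) \<le> R' BEST"
        if "k \<le> x" "x < n" "set xs \<subseteq> {..<n}" "length xs = d" for x xs
      proof (cases "x = k")
        case True
        then show ?thesis
          using 1 that by (auto simp: marked)
      next
        case False
        then have "score n E (marked n M \<union> insert x (set xs)) \<le> R1 BEST"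
          using I that by (auto simp: I_def)
        then show ?thesis
          using 1 B by simp
      qed
      have "I k (R3, M)"
        using 1 I R3 B cover unfolding I_def by auto
      then show ?case
        using 1 std' C M by (simp add: R3_def std_regs_def M1_def)
    qed
    then show "wp (Add ADDR LEN (COUNTER d) ;; Load MARK1 ADDR ;; Add MARK1 MARK1 ONE ;;
        Store ADDR MARK1 ;; enum d ;;
        Add ADDR LEN (COUNTER d) ;; Load MARK1 ADDR ;; Sub MARK1 MARK1 ONE ;; Store ADDR MARK1)
        (\<lambda>t s. t \<le> enum_time d n + 8 \<and> I k s) (R1(COUNTER d := k), M')"
      using std[OF I] by (simp add: R2_def std_regs_def M1_def)
  qed
  then show ?case
  proof (rule wp_mono, goal_cases)
    case (1 t R' M')
    have "score n E (marked n M \<union> set xs) \<le> R' BEST" if "set xs \<subseteq> {..<n}" "length xs = Suc d" for xs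
      using that 1 by (cases xs) (auto simp: I_def)
    with 1 show ?case
      by (auto simp: I_def)
  qed
qed

section \<open>The approximation algorithm\<close>

text \<open>The input length is \<open>n * n\<close>; its square root is found by stepping through
  the squares via \<open>(a + 1)^2 = a^2 + 2 * a + 1\<close>.\<close>

definition setup_regs :: com where
  "setup_regs = Assign ONE 1 ;; Assign EIGHT 8 ;; Add TMP LEN ZERO ;;
     While_Pos TMP (Add SQUARE SQUARE SIZE ;; Add SQUARE SQUARE SIZE ;; Add SQUARE SQUARE ONE ;;
       Add SIZE SIZE ONE ;; Sub TMP LEN SQUARE)"

text \<open>\<open>DEGSUM\<close> is twice the number of edges, so the test against 399 asks for at least 200 edges;
  the minimum is computed as \<open>min a b = a - (a - b)\<close> with truncated subtraction.\<close>

definition degree_bound :: com where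
  "degree_bound = Add TMP DEGSUM DEGSUM ;; Add OUT MAXDEG MAXDEG ;; Add OUT OUT OUT ;;
     Sub TMP TMP OUT ;; Sub OUT DEGSUM TMP ;; Sub TMP DEGSUM OUT ;;
     Assign OUT 399 ;; Sub OUT DEGSUM OUT ;;
     If_Pos OUT (Add BEST TMP ZERO) (Assign BEST 0)"

text \<open>Truncated subtraction in the last round makes this division round up.\<close>

definition divide_best :: com where
  "divide_best = Assign TMP 16 ;; Assign LEN 0 ;;
     While_Pos BEST (Sub BEST BEST TMP ;; Add LEN LEN ONE)"

definition load_coloring :: com where
  "load_coloring = setup_regs ;; degrees ;; degree_bound ;; enum 200 ;; divide_best"

lemma wp_setup_regs:
  assumes "R = (\<lambda>_. 0)(LEN := n * n)"
  shows "wp setup_regs (\<lambda>t (R', M'). t \<le> n * 6 + 4 \<and> M' = M \<and> std_regs n R' \<and>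
    R' MAXDEG = 0 \<and> R' DEGSUM = 0) (R, M)"
proof -
  define I where "I = (\<lambda>k (R', M'). M' = M \<and> (\<exists>a. a + k = n \<and> R' SIZE = a \<and>
    R' SQUARE = a * a \<and> R' TMP = n * n - a * a) \<and> R' LEN = n * n \<and> R' ONE = 1 \<and> R' ZERO = 0 \<and>
    R' EIGHT = 8 \<and> R' MAXDEG = 0 \<and> R' DEGSUM = 0)"
  have sq: "a * a < n * n" if "a < n" for a
    using that by (simp add: mult_strict_mono)
  have "wp (While_Pos TMP (Add SQUARE SQUARE SIZE ;; Add SQUARE SQUARE SIZE ;;
      Add SQUARE SQUARE ONE ;; Add SIZE SIZE ONE ;; Sub TMP LEN SQUARE))
      (\<lambda>t s. t \<le> n * (5 + 1) + 1 \<and> I 0 s) (R(ONE := 1, EIGHT := 8, TMP := n * n), M)"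
  proof (rule wp_While_Pos)
    show "I n (R(ONE := 1, EIGHT := 8, TMP := n * n), M)"
      by (simp add: I_def assms)
    show "0 < R TMP \<and> wp (Add SQUARE SQUARE SIZE ;; Add SQUARE SQUARE SIZE ;;
      Add SQUARE SQUARE ONE ;; Add SIZE SIZE ONE ;; Sub TMP LEN SQUARE) (\<lambda>t s. t \<le> 5 \<and> I i s) (R, M)"
      if I: "I (Suc i) (R, M)" for i R M
    proof -
      obtain a where "a + Suc i = n" "R SIZE = a" "R SQUARE = a * a" "R TMP = n * n - a * a"
        using I unfolding I_def prod.case by blast
      with I sq[of a] show ?thesis
        by (auto simp: I_def)
    qed
    show "R TMP = 0" if "I 0 (R, M)" for R M
      using that by (auto simp: I_def)
  qed
  then show ?thesis
    unfolding setup_regs_def by (simp add: assms) (erule wp_mono, auto simp: I_def std_regs_def)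
qed

text \<open>With \<open>DEGSUM\<close> equal to \<open>2 * m\<close> the minimum is
  \<open>4 * U\<close>, which is 16 times the unrounded target \<open>U / 4\<close>.\<close>

lemma wp_degree_bound:
  assumes "std_regs n R"
  shows "wp degree_bound (\<lambda>t (R', M'). t \<le> 10 \<and> M' = M \<and> std_regs n R' \<and>
    R' BEST = (if 400 \<le> R DEGSUM then min (R DEGSUM) (2 * R DEGSUM - 4 * R MAXDEG) else 0)) (R, M)"
  using assms unfolding degree_bound_def by (auto simp: std_regs_def)

lemma wp_divide_best:
  assumes "R ONE = 1"
  shows "wp divide_best (\<lambda>t (R', M'). t \<le> ((R BEST + 15) div 16) * 3 + 3 \<and>
    R' LEN = (R BEST + 15) div 16) (R, M)"
proof -
  define K where "K = (R BEST + 15) div 16"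
  define I :: "nat \<Rightarrow> state \<Rightarrow> bool" where
    "I = (\<lambda>k (R', M'). (R' BEST + 15) div 16 = k \<and> R' LEN + k = K \<and> R' ONE = 1 \<and> R' TMP = 16)"
  have "wp (While_Pos BEST (Sub BEST BEST TMP ;; Add LEN LEN ONE))
    (\<lambda>t s. t \<le> K * (2 + 1) + 1 \<and> I 0 s) (R(TMP := 16, LEN := 0), M)"
    by (rule wp_While_Pos) (auto simp: I_def K_def assms)
  then show ?thesis
    unfolding divide_best_def by simp (erule wp_mono, auto simp: I_def K_def)
qed

section \<open>Input encoding, the full run and the approximation guarantee\<close>

lemma concat_map_upt_nth:
  fixes f :: "nat \<Rightarrow> nat \<Rightarrow> 'a"
  assumes "i < m" "j < n"
  shows "concat (map (\<lambda>i. map (f i) [0..<n]) [0..<m]) ! (i * n + j) = f i j"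
  using assms(1)
proof (induction m)
  case (Suc m)
  have len: "length (concat (map (\<lambda>i. map (f i) [0..<n]) [0..<m])) = m * n"
    by (simp add: length_concat comp_def sum_list_triv)
  show ?case
  proof (cases "i = m")
    case True
    then show ?thesis
      using assms(2) len by (simp add: nth_append)
  next
    case False
    then have "i < m" using Suc.prems by simp
    moreover from this have "i * n + j < m * n"
      using assms(2) mult_le_mono1[of "Suc i" m n] by simp
    ultimately show ?thesis
      using Suc.IH len by (simp add: nth_append)
  qed
qed simp

lemma length_adjacency_word [simp]: "length (adjacency_word n E) = n * n"
  by (simp add: adjacency_word_def length_concat comp_def sum_list_triv)

lemma adjacency_word_nth:
  "i < n \<Longrightarrow> j < n \<Longrightarrow> adjacency_word n E ! (i * n + j) \<longleftrightarrow> {i, j} \<in> E"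
  by (simp add: adjacency_word_def concat_map_upt_nth)

lemma wpE:
  assumes "wp c Q s"
  obtains t R M where "exec c s t (R, M)" "Q t (R, M)"
  using assms unfolding wp_def by auto

lemma index_less_square: "i < n \<Longrightarrow> j < n \<Longrightarrow> i * n + j < n * (n :: nat)"
  using mult_le_mono1[of "Suc i" n n] by simp

text \<open>Interface between machine and graph theory: \<open>B0\<close> is the degree bound,
  \<open>B\<close> the final \<open>BEST\<close> after the enumeration.\<close>

lemma exec_load_coloring:
  assumes "simple_graph {..<n} E"
  obtains t s D B0 B where "exec load_coloring (input_state (adjacency_word n E)) t s"
    "\<And>v. v < n \<Longrightarrow> card (incident E v) \<le> D" "D = 0 \<or> (\<exists>v<n. card (incident E v) = D)"
    "B0 = (if 200 \<le> card E then min (2 * card E) (4 * card E - 4 * D) else 0)"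
    "B0 \<le> B" "B = B0 \<or> (\<exists>S\<subseteq>{..<n}. B = score n E S)"
    "\<And>xs. set xs \<subseteq> {..<n} \<Longrightarrow> length xs = 200 \<Longrightarrow> score n E (set xs) \<le> B"
    "result s = (B + 15) div 16"
    "t \<le> n * (n * 5 + 14) + 20 + enum_time 200 n + result s * 3"
proof -
  define M where "M = snd (input_state (adjacency_word n E))"
  have init: "input_state (adjacency_word n E) = ((\<lambda>_. 0)(LEN := n * n), M)"
    by (simp add: M_def input_state_def)
  have mem: "graph_mem n E M"
    unfolding graph_mem_def M_def input_state_def
    by (simp add: index_less_square adjacency_word_nth)
  have unmarked: "marked n M = {}"
    by (simp add: marked_def M_def input_state_def)
  obtain t1 R1 where 1: "exec setup_regs (input_state (adjacency_word n E)) t1 (R1, M)"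
    "t1 \<le> n * 6 + 4" "std_regs n R1" "R1 MAXDEG = 0" "R1 DEGSUM = 0"
    using wp_setup_regs[OF refl, of n M] unfolding init by (auto elim!: wpE)
  obtain t2 R2 where 2: "exec degrees (R1, M) t2 (R2, M)"
    "t2 \<le> n * (n * 5 + 6 + 2) + 3" "std_regs n R2" "R2 DEGSUM = 2 * card E"
    "\<forall>v<n. card (incident E v) \<le> R2 MAXDEG"
    "R2 MAXDEG = 0 \<or> (\<exists>v<n. card (incident E v) = R2 MAXDEG)"
    using wp_degrees[OF assms 1(3) mem 1(4,5)] by (elim wpE) (simp; blast)
  obtain t3 R3 where 3: "exec degree_bound (R2, M) t3 (R3, M)" "t3 \<le> 10" "std_regs n R3"
    "R3 BEST = (if 400 \<le> R2 DEGSUM then min (R2 DEGSUM) (2 * R2 DEGSUM - 4 * R2 MAXDEG) else 0)"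
    using wp_degree_bound[OF 2(3), of M] by (elim wpE) (simp; blast)
  obtain t4 R4 where 4: "exec (enum 200) (R3, M) t4 (R4, M)" "t4 \<le> enum_time 200 n"
    "agree_off (scratch \<union> {30..<30 + 200}) R3 R4" "R3 BEST \<le> R4 BEST"
    "R4 BEST = R3 BEST \<or> (\<exists>S\<subseteq>{..<n}. R4 BEST = score n E S)"
    "\<forall>xs. set xs \<subseteq> {..<n} \<longrightarrow> length xs = 200 \<longrightarrow> score n E (marked n M \<union> set xs) \<le> R4 BEST"
    using wp_enum[OF assms 3(3) mem, of 200] by (elim wpE) (simp only: prod.case; blast)
  have "R4 ONE = R3 ONE"
    by (rule agree_offD[OF 4(3)]) (simp add: scratch_def)
  then have "R4 ONE = 1"
    using 3(3) by (simp add: std_regs_def)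
  obtain t5 R5 M5 where 5: "exec divide_best (R4, M) t5 (R5, M5)"
    "t5 \<le> ((R4 BEST + 15) div 16) * 3 + 3" "R5 LEN = (R4 BEST + 15) div 16"
    using wp_divide_best[of R4 M, OF \<open>R4 ONE = 1\<close>] by (elim wpE) (simp only: prod.case; blast)
  show thesis
  proof (rule that[of "t1 + (t2 + (t3 + (t4 + t5)))" "(R5, M5)" "R2 MAXDEG" "R3 BEST" "R4 BEST"])
    show "exec load_coloring (input_state (adjacency_word n E)) (t1 + (t2 + (t3 + (t4 + t5)))) (R5, M5)"
      unfolding load_coloring_def using 1(1) 2(1) 3(1) 4(1) 5(1) by (intro exec.Seq)
    show "t1 + (t2 + (t3 + (t4 + t5))) \<le> n * (n * 5 + 14) + 20 + enum_time 200 n + result (R5, M5) * 3"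
      using 1(2) 2(2) 3(2) 4(2) 5(2,3) unfolding result_def fst_conv distrib_left by linarith
    show "card (incident E v) \<le> R2 MAXDEG" if "v < n" for v
      using 2(5) that by simp
    show "R3 BEST = (if 200 \<le> card E then min (2 * card E) (4 * card E - 4 * R2 MAXDEG) else 0)"
      using 3(4) 2(4) by simp
    show "score n E (set xs) \<le> R4 BEST" if "set xs \<subseteq> {..<n}" "length xs = 200" for xs
      using 4(6) that unmarked by auto
    show "result (R5, M5) = (R4 BEST + 15) div 16"
      using 5(3) by (simp add: result_def)
  qed (fact 2(6) 4(4,5))+
qed

text \<open>Both possible sources of \<open>B\<close> are attained after division by 16. For the
  ratio, the degree bound gives \<open>4 * k_opt \<le> B\<close> on large graphs, and the
  enumeration gives \<open>16 * k_opt \<le> B\<close> on small ones.\<close>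

lemma score_bound_correct:
  assumes E: "simple_graph {..<n} E"
    and D: "\<And>v. v < n \<Longrightarrow> card (incident E v) \<le> D" "D = 0 \<or> (\<exists>v<n. card (incident E v) = D)"
    and B0: "B0 = (if 200 \<le> card E then min (2 * card E) (4 * card E - 4 * D) else 0)"
    and B: "B0 \<le> B" "B = B0 \<or> (\<exists>S\<subseteq>{..<n}. B = score n E S)"
      "\<And>xs. set xs \<subseteq> {..<n} \<Longrightarrow> length xs = 200 \<Longrightarrow> score n E (set xs) \<le> B"
  shows "in_LCP2 {..<n} E ((B + 15) div 16)" and "k_opt {..<n} E \<le> 4 * ((B + 15) div 16)"
proof -
  define K where "K = (B + 15) div 16"
  have K: "16 * K \<le> B + 15" "B \<le> 16 * K"
    unfolding K_def by linarith+
  \<comment> \<open>If \<open>D = 0\<close>, vertex 0 attains it; an edge guarantees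
    \<open>n > 0\<close>.\<close>
  have max_deg: "\<exists>v<n. card (incident E v) = D" if "E \<noteq> {}"
  proof -
    have "n > 0"
      using that simple_graph_edge[OF E] by (cases n) fastforce+
    then show ?thesis
      using D(1)[of 0] D(2) by auto
  qed
  show "in_LCP2 {..<n} E ((B + 15) div 16)"
    using B(2)
  proof
    assume "\<exists>S\<subseteq>{..<n}. B = score n E S"
    then obtain S where S: "S \<subseteq> {..<n}" "B = score n E S" by auto
    \<comment> \<open>A score is a multiple of 16, so rounding up changes nothing.\<close>
    then have "K = min (card (induced E S)) (card (induced E ({..<n} - S)))"
      by (simp add: K_def score_def)
    then show ?thesis
      using S(1) unfolding K_def[symmetric] in_LCP2_iff[OF E] by (intro exI[of _ S]) auto
  next
    assume BB0: "B = B0"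
    show ?thesis
    proof (cases "200 \<le> card E")
      case True
      then have "E \<noteq> {}" by auto
      then obtain v where v: "v < n" "card (incident E v) = D"
        using max_deg by auto
      \<comment> \<open>Ensures that the subtraction in \<open>B0\<close> does not truncate.\<close>
      have "D \<le> card E"
        using v(2) simple_graph_finite[OF E] by (auto simp: incident_def intro!: card_mono)
      then show ?thesis
        unfolding K_def[symmetric] using v True K BB0 B0 D(1)
        by (intro in_LCP2_lower_bound[OF E, of D v]) auto
    next
      case False
      then show ?thesis
        using BB0 B0 in_LCP2_0 by simp
    qed
  qed
  define k where "k = k_opt {..<n} E"
  have k: "in_LCP2 {..<n} E k"
    unfolding k_def by (rule k_opt(1)[OF E])
  have "k \<le> 4 * K"
  proof (cases "200 \<le> card E")
    case True
    then have "E \<noteq> {}" by auto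
    then obtain v where v: "v < n" "card (incident E v) = D"
      using max_deg by auto
    have "4 * k \<le> B0"
      using in_LCP2_upper_bounds(1)[OF E k] in_LCP2_upper_bounds(2)[OF E k, of v] v True B0 by auto
    then show ?thesis
      using K B(1) by linarith
  next
    case False
    obtain S where S: "S \<subseteq> {..<n}" "card S \<le> 2 * k"
      "k \<le> card (induced E S)" "k \<le> card (induced E ({..<n} - S))"
      using in_LCP2_small_class[OF E k] by blast
    \<comment> \<open>At most 199 edges and \<open>2 * k \<le> card E\<close> leave at most 199
      vertices in \<open>S\<close>.\<close>
    have "card S \<le> 200"
      using S(2) in_LCP2_upper_bounds(1)[OF E k] False by linarith
    show ?thesis
    \<comment> \<open>The padding below repeats an element of \<open>S\<close>; an empty
      \<open>S\<close> forces \<open>k = 0\<close>.\<close>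
    proof (cases "S = {}")
      case True
      have "induced E {} = {}"
        using simple_graph_edge(2)[OF E] by (force simp: induced_def)
      then show ?thesis
        using S(3) True by simp
    next
      case False
      obtain ys where ys: "set ys = S" "length ys = card S"
        using finite_distinct_list[of S] finite_subset[OF S(1)] distinct_card by fastforce
      define xs where "xs = ys @ replicate (200 - length ys) (hd ys)"
      have "set xs = S" "length xs = 200"
        using ys False \<open>card S \<le> 200\<close> hd_in_set[of ys] by (auto simp: xs_def)
      then have "score n E S \<le> B"
        using B(3)[of xs] S(1) by simp
      moreover have "16 * k \<le> score n E S"
        using S by (simp add: score_def)
      ultimately show ?thesis
        using K(2) by linarith
    qed
  qed
  then show "k_opt {..<n} E \<le> 4 * ((B + 15) div 16)"
    by (simp add: k_def K_def)
qed

theorem theorem5: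
  fixes \<epsilon> :: real
  assumes "\<epsilon> > 0"
  shows "\<exists>c. load_coloring_approximation (4 + \<epsilon>) c"
proof -
  obtain q where q: "enum_time 200 n \<le> poly q (n * n)" for n
    using enum_time_poly by blast
  \<comment> \<open>The coefficient 22 is 5 + 14 + 3: the quadratic term, the linear term bounded by
    \<open>n * n\<close>, and the final division with \<open>result s \<le> n * n\<close>.\<close>
  have "\<exists>t s. exec load_coloring (input_state (adjacency_word n E)) t s
      \<and> t \<le> poly (q + [:20, 22:]) (length (adjacency_word n E))
      \<and> in_LCP2 {..<n} E (result s)
      \<and> real (k_opt {..<n} E) \<le> (4 + \<epsilon>) * real (result s)"
    if E: "simple_graph {..<n} E" for n E
  proof -
    obtain t s D B0 B where run: "exec load_coloring (input_state (adjacency_word n E)) t s"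
      "\<And>v. v < n \<Longrightarrow> card (incident E v) \<le> D" "D = 0 \<or> (\<exists>v<n. card (incident E v) = D)"
      "B0 = (if 200 \<le> card E then min (2 * card E) (4 * card E - 4 * D) else 0)"
      "B0 \<le> B" "B = B0 \<or> (\<exists>S\<subseteq>{..<n}. B = score n E S)"
      "\<And>xs. set xs \<subseteq> {..<n} \<Longrightarrow> length xs = 200 \<Longrightarrow> score n E (set xs) \<le> B"
      "result s = (B + 15) div 16"
      "t \<le> n * (n * 5 + 14) + 20 + enum_time 200 n + result s * 3"
      by (rule exec_load_coloring[OF E]; rule that; assumption)
    note correct = score_bound_correct[OF E run(2-7), folded run(8)]
    have "card (incident E v) \<le> n" for v
      using card_mono[OF _ nbrs_subset[OF E, of v]] card_Diff1_le[of "{..<n}" v]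
      by (simp add: card_incident[OF E])
    then have "(\<Sum>v<n. card (incident E v)) \<le> n * n"
      using sum_bounded_above[of "{..<n}" "\<lambda>v. card (incident E v)" n] by simp
    then have "result s \<le> n * n"
      using handshake[OF E] in_LCP2_upper_bounds(1)[OF E correct(1)] by linarith
    moreover have "n * (n * 5 + 14) = 5 * (n * n) + 14 * n"
      "poly (q + [:20, 22:]) (n * n) = poly q (n * n) + 20 + 22 * (n * n)"
      by (simp_all add: algebra_simps)
    ultimately have t: "t \<le> poly (q + [:20, 22:]) (n * n)"
      using run(9) q[of n] le_square[of n] by linarith
    have "real (k_opt {..<n} E) \<le> real (4 * result s)"
      using correct(2) by (simp only: of_nat_le_iff)
    then have "real (k_opt {..<n} E) \<le> 4 * real (result s)"
      by simp
    also have "\<dots> \<le> (4 + \<epsilon>) * real (result s)"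
      using assms by (intro mult_right_mono) auto
    finally show ?thesis
      using t run(1) correct(1) unfolding length_adjacency_word by blast
  qed
  then show ?thesis
    unfolding load_coloring_approximation_def by blast
qed

end
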